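(* A real 2-step solvable Frobenius Lie algebra of dimension $2n\le 6$ is (up to isomorphism) either of the form $\mathcal G_\psi=\mathbb R[\psi]\ltimes\mathbb R^n$ for some nonderogatory endomorphism $\psi$ of $\mathbb R^n$, or isomorphic to $\mathcal G_{3,1}$. Consequently, a real 2-step solvable Frobenius Lie algebra of dimension less than or equal to $6$ is isomorphic either to one of $\mathfrak{aff}(\mathbb R)$, $\mathfrak D_0^2$, $\mathfrak{aff}(\mathbb C)$, $\mathfrak D_0^3$, $\mathcal G_{3,1}$, or to one of the direct sums $\mathfrak{aff}(\mathbb R)\oplus\mathfrak{aff}(\mathbb R)$, $\mathfrak D_0^2\oplus\mathfrak{aff}(\mathbb R)$, $\mathfrak{aff}(\mathbb C)\oplus\mathfrak{aff}(\mathbb R)$, $\mathfrak{aff}(\mathbb R)\oplus\mathfrak{aff}(\mathbb R)\oplus\mathfrak{aff}(\mathbb R)$.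
   Context: A Lie algebra $\mathcal G$ is 2-step solvable if $[\mathcal G,\mathcal G]$ is Abelian. It is Frobenius if there is $\alpha\in\mathcal G^*$ such that the form $\partial\alpha(u,v):=-\alpha([u,v])$ is nondegenerate (so $\dim\mathcal G$ is even; here $n\ge1$). An endomorphism (or square matrix) is nonderogatory if its characteristic and minimal polynomials coincide. For an Abelian Lie algebra $\mathfrak B$ of $n\times n$ real matrices, $\mathfrak B\ltimes\mathbb R^n$ is $\mathfrak B\oplus\mathbb R^n$ with $[a,b]=[x,y]=0$, $[a,x]=ax$ ($a,b\in\mathfrak B$, $x,y\in\mathbb R^n$); $\mathcal G_\psi:=\mathbb R[\psi]\ltimes\mathbb R^n$, where $\mathbb R[\psi]$ is the algebra of real polynomials in $\psi$. $E_{i,j}$ denotes the matrix with $(i,j)$ entry $1$ and all others $0$. $\mathcal G_{3,1}:=\mathfrak B_{3,1}\ltimes\mathbb R^3$ with $\mathfrak B_{3,1}$ spanned by the identity matrix, $E_{1,2}$ and $E_{1,3}$ in $\mathfrak{gl}(3,\mathbb R)$. $\mathfrak D_0^n:=\mathcal G_{M_0}$ with $M_0=\sum_{i=1}^{n-1}E_{i,i+1}$ ($n\times n$). $\mathfrak{aff}(\mathbb R)$: basis $(e_1,e_2)$, $[e_1,e_2]=e_2$. $\mathfrak{aff}(\mathbb C)$ (as a real Lie algebra): basis $(e_1,\dots,e_4)$, $[e_1,e_3]=e_3$, $[e_1,e_4]=e_4$, $[e_2,e_3]=e_4$, $[e_2,e_4]=-e_3$. *)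

theory Defs
  imports "HOL-Analysis.Analysis" "HOL-Computational_Algebra.Polynomial"
begin

text \<open>
  A Lie algebra is a linear subspace of an ambient real vector space together with a bracket.
  Only the values of the bracket on the carrier matter.
\<close>

record 'a lie =
  lcarrier :: "'a set"
  lbracket :: "'a \<Rightarrow> 'a \<Rightarrow> 'a"

locale lie_algebra =
  fixes L :: "'a::real_vector lie"
  assumes subspace_carrier: "subspace (lcarrier L)"
    and bracket_closed: "x \<in> lcarrier L \<Longrightarrow> y \<in> lcarrier L \<Longrightarrow> lbracket L x y \<in> lcarrier L"
    and bracket_linear_left: "x \<in> lcarrier L \<Longrightarrow> y \<in> lcarrier L \<Longrightarrow> z \<in> lcarrier L \<Longrightarrow>
      lbracket L (a *\<^sub>R x + b *\<^sub>R y) z = a *\<^sub>R lbracket L x z + b *\<^sub>R lbracket L y z"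
    and bracket_linear_right: "x \<in> lcarrier L \<Longrightarrow> y \<in> lcarrier L \<Longrightarrow> z \<in> lcarrier L \<Longrightarrow>
      lbracket L z (a *\<^sub>R x + b *\<^sub>R y) = a *\<^sub>R lbracket L z x + b *\<^sub>R lbracket L z y"
    and bracket_alternating: "x \<in> lcarrier L \<Longrightarrow> lbracket L x x = 0"
    and jacobi: "x \<in> lcarrier L \<Longrightarrow> y \<in> lcarrier L \<Longrightarrow> z \<in> lcarrier L \<Longrightarrow>
      lbracket L x (lbracket L y z) + lbracket L y (lbracket L z x)
        + lbracket L z (lbracket L x y) = 0"

definition lin_on :: "'a::real_vector set \<Rightarrow> ('a \<Rightarrow> 'b::real_vector) \<Rightarrow> bool" where
  "lin_on S f \<longleftrightarrow>
     (\<forall>x\<in>S. \<forall>y\<in>S. \<forall>a b. f (a *\<^sub>R x + b *\<^sub>R y) = a *\<^sub>R f x + b *\<^sub>R f y)"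

definition lie_iso :: "'a::real_vector lie \<Rightarrow> 'b::real_vector lie \<Rightarrow> bool" (infix "\<cong>\<^sub>L" 50) where
  "L \<cong>\<^sub>L M \<longleftrightarrow> (\<exists>f. lin_on (lcarrier L) f \<and> bij_betw f (lcarrier L) (lcarrier M) \<and>
     (\<forall>x\<in>lcarrier L. \<forall>y\<in>lcarrier L. f (lbracket L x y) = lbracket M (f x) (f y)))"

definition derived_algebra :: "'a::real_vector lie \<Rightarrow> 'a set" where
  "derived_algebra L = span {lbracket L x y | x y. x \<in> lcarrier L \<and> y \<in> lcarrier L}"

definition two_step_solvable :: "'a::real_vector lie \<Rightarrow> bool" where
  "two_step_solvable L \<longleftrightarrow>
     (\<forall>x\<in>derived_algebra L. \<forall>y\<in>derived_algebra L. lbracket L x y = 0)"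

definition coboundary :: "'a lie \<Rightarrow> ('a \<Rightarrow> real) \<Rightarrow> 'a \<Rightarrow> 'a \<Rightarrow> real" where
  "coboundary L \<alpha> u v = - \<alpha> (lbracket L u v)"

text \<open>The form is skew-symmetric, so that its left kernel is also its right kernel.\<close>

definition frobenius :: "'a::real_vector lie \<Rightarrow> bool" where
  "frobenius L \<longleftrightarrow> (\<exists>\<alpha>. lin_on (lcarrier L) \<alpha> \<and>
     (\<forall>u\<in>lcarrier L. (\<forall>v\<in>lcarrier L. coboundary L \<alpha> u v = 0) \<longrightarrow> u = 0))"

definition lie_sum :: "'a::real_vector lie \<Rightarrow> 'b::real_vector lie \<Rightarrow> ('a \<times> 'b) lie"
    (infixl "\<oplus>\<^sub>L" 65) where
  "L \<oplus>\<^sub>L M = \<lparr> lcarrier = lcarrier L \<times> lcarrier M,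
     lbracket = (\<lambda>(x, y) (x', y'). (lbracket L x x', lbracket M y y')) \<rparr>"

text \<open>
  The type of square matrices carries the componentwise product as \<open>*\<close>, hence powers and
  polynomials of a matrix are written out with the matrix product \<open>**\<close>.
\<close>

definition mat_pow :: "real^'n^'n \<Rightarrow> nat \<Rightarrow> real^'n^'n" where
  "mat_pow A k = (((**) A) ^^ k) (mat 1)"

definition poly_mat :: "real poly \<Rightarrow> real^'n^'n \<Rightarrow> real^'n^'n" where
  "poly_mat p A = (\<Sum>i\<le>degree p. coeff p i *\<^sub>R mat_pow A i)"

definition char_poly :: "real^'n^'n \<Rightarrow> real poly" where
  "char_poly A = det (mat [:0, 1:] - (\<chi> i j. [:A $ i $ j:]))"

definition is_min_poly :: "real poly \<Rightarrow> real^'n^'n \<Rightarrow> bool" where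
  "is_min_poly p A \<longleftrightarrow> lead_coeff p = 1 \<and> poly_mat p A = 0 \<and>
     (\<forall>q. q \<noteq> 0 \<and> poly_mat q A = 0 \<longrightarrow> degree p \<le> degree q)"

definition nonderogatory :: "real^'n^'n \<Rightarrow> bool" where
  "nonderogatory A \<longleftrightarrow> is_min_poly (char_poly A) A"

text \<open>\<open>[a + x, b + y] = a y - b x\<close>; this is a Lie algebra when the matrices in \<open>B\<close> commute.\<close>

definition semidirect :: "(real^'n^'n) set \<Rightarrow> ((real^'n^'n) \<times> (real^'n)) lie" where
  "semidirect B = \<lparr> lcarrier = B \<times> UNIV,
     lbracket = (\<lambda>(a, x) (b, y). (0, a *v y - b *v x)) \<rparr>"

definition matrix_polys :: "real^'n^'n \<Rightarrow> (real^'n^'n) set" where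
  "matrix_polys \<psi> = {poly_mat p \<psi> | p. True}"

definition G_psi :: "real^'n^'n \<Rightarrow> ((real^'n^'n) \<times> (real^'n)) lie" where
  "G_psi \<psi> = semidirect (matrix_polys \<psi>)"

text \<open>
  The numeral types \<open>2\<close>, \<open>3\<close>, \<open>4\<close> are the integers modulo \<open>2\<close>, \<open>3\<close>, \<open>4\<close>, so the index \<open>n\<close> of
  type \<open>n\<close> equals \<open>0\<close>; the indices \<open>1, \<dots>, n\<close> are the distinct elements of the type.
\<close>

definition E :: "'n \<Rightarrow> 'n \<Rightarrow> real^'n^'n" where
  "E i j = (\<chi> k l. if k = i \<and> l = j then 1 else 0)"

definition B_3_1 :: "(real^3^3) set" where
  "B_3_1 = span {mat 1, E 1 2, E 1 3}"

definition G_3_1 :: "((real^3^3) \<times> (real^3)) lie" where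
  "G_3_1 = semidirect B_3_1"

text \<open>Used at the index types \<open>2\<close> and \<open>3\<close>, see \<open>M_0_2\<close> and \<open>M_0_3\<close> below.\<close>

definition M_0 :: "real^'n::{finite,semiring_1}^'n::{finite,semiring_1}" where
  "M_0 = (\<Sum>i = 1..CARD('n) - 1. E (of_nat i) (of_nat (i + 1)))"

definition D_0 :: "((real^'n::{finite,semiring_1}^'n::{finite,semiring_1})
    \<times> (real^'n::{finite,semiring_1})) lie" where
  "D_0 = G_psi M_0"

definition wedge :: "'n \<Rightarrow> 'n \<Rightarrow> real^'n \<Rightarrow> real^'n \<Rightarrow> real" where
  "wedge i j x y = x $ i * y $ j - x $ j * y $ i"

text \<open>
  The basis vectors \<open>e\<^sub>i\<close> are \<open>axis i 1\<close>; the brackets of basis vectors are computed in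
  \<open>aff_R_bracket\<close> and \<open>aff_C_bracket\<close> below.
\<close>

definition aff_R :: "(real^2) lie" where
  "aff_R = \<lparr> lcarrier = UNIV, lbracket = (\<lambda>x y. wedge 1 2 x y *\<^sub>R axis 2 1) \<rparr>"

definition aff_C :: "(real^4) lie" where
  "aff_C = \<lparr> lcarrier = UNIV,
     lbracket = (\<lambda>x y. (wedge 1 3 x y - wedge 2 4 x y) *\<^sub>R axis 3 1
                     + (wedge 1 4 x y + wedge 2 3 x y) *\<^sub>R axis 4 1) \<rparr>"

lemma M_0_2: "(M_0 :: real^2^2) = E 1 2"
  by (simp add: M_0_def)

lemma M_0_3: "(M_0 :: real^3^3) = E 1 2 + E 2 3"
  by (simp add: M_0_def numeral_2_eq_2)

lemma aff_R_bracket: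
  "lbracket aff_R (axis 1 1) (axis 2 1) = axis 2 1"
  by (simp add: aff_R_def wedge_def axis_def)

lemma aff_C_bracket:
  "lbracket aff_C (axis 1 1) (axis 2 1) = 0"
  "lbracket aff_C (axis 1 1) (axis 3 1) = axis 3 1"
  "lbracket aff_C (axis 1 1) (axis 4 1) = axis 4 1"
  "lbracket aff_C (axis 2 1) (axis 3 1) = axis 4 1"
  "lbracket aff_C (axis 2 1) (axis 4 1) = - axis 3 1"
  "lbracket aff_C (axis 3 1) (axis 4 1) = 0"
  by (simp_all add: aff_C_def wedge_def axis_def)

end

theory Submission
  imports Defs
begin

text \<open>
  Let \<open>e\<close> represent a nondegenerate functional \<open>\<alpha>\<close>, that is \<open>\<alpha> [e, v] = \<alpha> v\<close> for all \<open>v\<close>. Two-step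
  solvability makes \<open>ad e\<close> a projection onto the derived algebra \<open>D\<close>, so that the algebra is the
  semidirect product of the centralizer \<open>B\<close> of \<open>e\<close>, which is abelian, and \<open>D\<close>. The pairing
  \<open>(b, d) \<mapsto> \<alpha> [b, d]\<close> identifies \<open>D\<close> with the dual of \<open>B\<close>, and the operators \<open>ad b\<close> on \<open>D\<close> are closed
  under composition, so \<open>B\<close> is a commutative associative unital algebra acting on its own dual.
  In dimension at most 3 such an algebra is, up to isomorphism, a product of algebras
  \<open>\<real>\<close>, \<open>\<complex>\<close>, \<open>\<real>[t]/(t\<^sup>k)\<close>, or \<open>\<real>[s, t]/(s, t)\<^sup>2\<close>. All but the last are generated by one element
  and self-dual; the last one gives \<open>G_3_1\<close>.
\<close>

section \<open>Lie algebra isomorphisms and coordinates\<close>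

text \<open>Closure of the operators \<open>ad b\<close> under composition is not part of the Lie
  structure. It holds because nondegeneracy represents every functional, in particular d \<mapsto>
  \<alpha> [b, [c, d]], by an element, and because operators from the commuting family
  \<open>ad b\<close> on D are determined by their composition with \<alpha>. If one element
  generates B, then all operators on the dual are polynomials in the operator \<psi> of that
  element, and \<psi> is nonderogatory because its powers below n are independent. In R[s, t]/(s,
  t)^2 every element is a scalar plus a square-zero element and generates a subalgebra of dimension
  at most 2, so no single \<psi> can serve. The classification in dimension 3 rests on parity: a
  real cubic has a root, and no element squares to -1. Two matters of form shape the rest.
  \<open>L\<close> lives in an arbitrary real vector space and only its carrier is controlled,
  whence the passage to coordinates. The index type \<open>'n\<close> of the theorem is arbitrary,
  while the normal forms live on the numeral types 1, 2 and 3, whence the change of index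
  type.\<close>

lemma subspace_coordinates:
  fixes V :: "'a::real_vector set"
  assumes "subspace V" and "dim V = CARD('n::finite)"
  obtains \<phi> :: "real^'n \<Rightarrow> 'a" where "linear \<phi>" "inj \<phi>" "range \<phi> = V"
proof -
  obtain S where S: "S \<subseteq> V" "independent S" "V \<subseteq> span S" "card S = CARD('n)"
    using basis_exists[of V] assms(2) by metis
  \<comment> \<open>\<open>card\<close> of an infinite set is 0, so a positive value of
    \<open>dim\<close> already forces finite dimension.\<close>
  have fin: "finite S"
    using S(4) by (metis card.infinite zero_less_card_finite less_irrefl)
  obtain h :: "'n \<Rightarrow> 'a" where h: "bij_betw h UNIV S"
    using finite_same_card_bij[of "UNIV :: 'n set" S] fin S(4) by auto
  define \<phi> where "\<phi> x = (\<Sum>i\<in>UNIV. x $ i *\<^sub>R h i)" for x :: "real^'n"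
  have lin: "linear \<phi>"
    unfolding \<phi>_def by (intro linearI) (simp_all add: scaleR_add_left sum.distrib scaleR_sum_right)
  have re: "(\<Sum>i\<in>UNIV. u (h i) *\<^sub>R h i) = (\<Sum>s\<in>S. u s *\<^sub>R s)" for u
    using sum.reindex_bij_betw[OF h, of "\<lambda>s. u s *\<^sub>R s"] .
  have inv: "inv h (h i) = i" for i
    using h by (simp add: bij_betw_def)
  have "x = 0" if "\<phi> x = 0" for x
  proof -
    have "(\<Sum>s\<in>S. (x $ inv h s) *\<^sub>R s) = 0"
      using that re[of "\<lambda>s. x $ inv h s"] by (simp add: \<phi>_def inv)
    then have "x $ inv h s = 0" if "s \<in> S" for s
      using independentD[OF S(2) fin order_refl, of "\<lambda>s. x $ inv h s" s] that by simp
    then have "x $ i = 0" for i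
      using h inv[of i] by (metis bij_betwE UNIV_I)
    then show ?thesis by (simp add: vec_eq_iff)
  qed
  then have inj: "inj \<phi>" by (simp add: linear_injective_0[OF lin])
  have "range \<phi> = span S"
  proof
    show "range \<phi> \<subseteq> span S"
      unfolding \<phi>_def using h
      by (auto intro!: span_sum span_scale intro: span_base dest: bij_betwE)
    show "span S \<subseteq> range \<phi>"
    proof
      fix v assume "v \<in> span S"
      then obtain u where "v = (\<Sum>s\<in>S. u s *\<^sub>R s)" using span_finite[OF fin] by auto
      then have "v = \<phi> (\<chi> i. u (h i))" by (simp add: \<phi>_def re)
      then show "v \<in> range \<phi>" by blast
    qed
  qed
  moreover have "span S = V"
    using S assms(1) by (simp add: span_subspace)
  ultimately show thesis using that lin inj by blast
qed

lemma lie_iso_trans: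
  assumes "L \<cong>\<^sub>L M" and "M \<cong>\<^sub>L N"
  shows "L \<cong>\<^sub>L N"
proof -
  obtain f where f: "lin_on (lcarrier L) f" "bij_betw f (lcarrier L) (lcarrier M)"
     "\<forall>x\<in>lcarrier L. \<forall>y\<in>lcarrier L. f (lbracket L x y) = lbracket M (f x) (f y)"
    using assms(1) unfolding lie_iso_def by blast
  obtain g where g: "lin_on (lcarrier M) g" "bij_betw g (lcarrier M) (lcarrier N)"
     "\<forall>x\<in>lcarrier M. \<forall>y\<in>lcarrier M. g (lbracket M x y) = lbracket N (g x) (g y)"
    using assms(2) unfolding lie_iso_def by blast
  have mem: "f x \<in> lcarrier M" if "x \<in> lcarrier L" for x
    using f(2) that by (auto dest: bij_betwE)
  have "lin_on (lcarrier L) (g \<circ> f)"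
    using f(1) g(1) mem unfolding lin_on_def by simp
  moreover have "bij_betw (g \<circ> f) (lcarrier L) (lcarrier N)"
    using f(2) g(2) by (rule bij_betw_trans)
  ultimately show ?thesis
    unfolding lie_iso_def using f(3) g(3) mem by (intro exI[of _ "g \<circ> f"]) simp
qed

lemma lie_iso_linearI:
  assumes lin: "linear f" and inj: "inj_on f (lcarrier L)" and im: "f ` lcarrier L = lcarrier M"
    and br: "\<And>x y. x \<in> lcarrier L \<Longrightarrow> y \<in> lcarrier L \<Longrightarrow>
      f (lbracket L x y) = lbracket M (f x) (f y)"
  shows "L \<cong>\<^sub>L M"
  unfolding lie_iso_def lin_on_def bij_betw_def using assms
  by (intro exI[of _ f]) (auto simp: linear_add linear_scale)

text \<open>A coordinate map runs from the model into \<open>L\<close>, against the direction of the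
  isomorphism sought. Its inverse is known to be linear only on \<open>range g\<close>, which is why
  \<open>lin_on\<close> is relative to a set.\<close>

lemma lie_iso_linear_symI:
  fixes g :: "'b::real_vector \<Rightarrow> 'a::real_vector"
  assumes lin: "linear g" and inj: "inj g" and im: "range g = lcarrier L"
    and UNIV: "lcarrier M = UNIV"
    and br: "\<And>x y. g (lbracket M x y) = lbracket L (g x) (g y)"
  shows "L \<cong>\<^sub>L M"
  unfolding lie_iso_def
proof (intro exI conjI ballI)
  have gi: "g (inv g x) = x" if "x \<in> lcarrier L" for x
    using that im by (auto intro: f_inv_into_f)
  show "lin_on (lcarrier L) (inv g)"
    unfolding lin_on_def
  proof (intro ballI allI)
    fix x y a b assume "x \<in> lcarrier L" "y \<in> lcarrier L"
    then have "a *\<^sub>R x + b *\<^sub>R y = g (a *\<^sub>R inv g x + b *\<^sub>R inv g y)"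
      by (simp add: linear_add[OF lin] linear_scale[OF lin] gi)
    then show "inv g (a *\<^sub>R x + b *\<^sub>R y) = a *\<^sub>R inv g x + b *\<^sub>R inv g y"
      using inj by simp
  qed
  show "bij_betw (inv g) (lcarrier L) (lcarrier M)"
    using inj im UNIV by (metis bij_betw_def bij_betw_inv_into)
  fix x y assume "x \<in> lcarrier L" "y \<in> lcarrier L"
  then show "inv g (lbracket L x y) = lbracket M (inv g x) (inv g y)"
    using inj br[of "inv g x" "inv g y"] by (simp add: gi) (metis inv_f_f)
qed

text \<open>The hypotheses in coordinates: the bracket is total on a Euclidean space, where
  injective endomorphisms are surjective and adjoints are available. By bilinearity,
  \<open>two_step\<close> on single brackets amounts to commutativity of the derived algebra. The
  sign in \<open>coboundary\<close> does not change the kernel of the form and is dropped.\<close>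

locale frobenius_bracket =
  fixes br :: "'v::euclidean_space \<Rightarrow> 'v \<Rightarrow> 'v" and \<alpha> :: "'v \<Rightarrow> real"
  assumes bilinear: "bilinear br" and alternating: "br x x = 0"
    and jacobi: "br x (br y z) + br y (br z x) + br z (br x y) = 0"
    and two_step: "br (br x y) (br z w) = 0"
    and linear_functional: "linear \<alpha>"
    and nondegenerate: "(\<And>v. \<alpha> (br u v) = 0) \<Longrightarrow> u = 0"

lemma frobenius_bracket_coordinates:
  fixes L :: "'a::real_vector lie"
  assumes "lie_algebra L" and "dim (lcarrier L) = CARD('k::finite)"
    and "two_step_solvable L" and "frobenius L"
  obtains br and \<alpha> where "frobenius_bracket br \<alpha>"
    and "L \<cong>\<^sub>L \<lparr>lcarrier = UNIV :: (real^'k) set, lbracket = br\<rparr>"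
proof -
  interpret lie_algebra L by fact
  obtain \<phi> :: "real^'k \<Rightarrow> 'a" where \<phi>: "linear \<phi>" "inj \<phi>" "range \<phi> = lcarrier L"
    using subspace_coordinates[OF subspace_carrier assms(2)] .
  obtain \<alpha> where \<alpha>: "lin_on (lcarrier L) \<alpha>"
    "\<forall>u\<in>lcarrier L. (\<forall>v\<in>lcarrier L. coboundary L \<alpha> u v = 0) \<longrightarrow> u = 0"
    using assms(4) unfolding frobenius_def by blast
  have mem [simp]: "\<phi> x \<in> lcarrier L" for x using \<phi>(3) by blast
  define br where "br x y = inv \<phi> (lbracket L (\<phi> x) (\<phi> y))" for x y
  have \<phi>_br: "\<phi> (br x y) = lbracket L (\<phi> x) (\<phi> y)" for x y
    unfolding br_def using bracket_closed[of "\<phi> x" "\<phi> y"] \<phi>(3)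
    by (auto intro: f_inv_into_f)
  have eqI: "x = y" if "\<phi> x = \<phi> y" for x y using that \<phi>(2) by (simp add: inj_def)
  note lin = linear_add[OF \<phi>(1)] linear_scale[OF \<phi>(1)] linear_0[OF \<phi>(1)]
  have add_l: "lbracket L (x + y) z = lbracket L x z + lbracket L y z"
    and add_r: "lbracket L z (x + y) = lbracket L z x + lbracket L z y"
    and scale_l: "lbracket L (r *\<^sub>R x) z = r *\<^sub>R lbracket L x z"
    and scale_r: "lbracket L z (r *\<^sub>R x) = r *\<^sub>R lbracket L z x"
    if "x \<in> lcarrier L" "y \<in> lcarrier L" "z \<in> lcarrier L" for x y z r
    using that bracket_linear_left[of x y z 1 1] bracket_linear_right[of x y z 1 1]
      bracket_linear_left[of x y z r 0] bracket_linear_right[of x y z r 0]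
    by simp_all
  have "frobenius_bracket br (\<alpha> \<circ> \<phi>)"
  proof (rule frobenius_bracket.intro)
    show "bilinear br"
      unfolding bilinear_def
      by (intro conjI allI linearI; rule eqI)
        (simp_all add: lin \<phi>_br add_l add_r scale_l[OF _ mem mem] scale_r[OF _ mem mem]
          scale_l[OF mem _ mem])
    show "br x x = 0" for x
      by (rule eqI) (simp add: lin \<phi>_br bracket_alternating)
    show "br x (br y z) + br y (br z x) + br z (br x y) = 0" for x y z
      by (rule eqI) (simp add: lin \<phi>_br jacobi)
    show "br (br x y) (br z w) = 0" for x y z w
    proof (rule eqI)
      have "lbracket L (\<phi> x) (\<phi> y) \<in> derived_algebra L" for x y
        unfolding derived_algebra_def using mem by (intro span_base) blast
      then show "\<phi> (br (br x y) (br z w)) = \<phi> 0"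
        using assms(3) unfolding two_step_solvable_def by (simp add: \<phi>_br lin)
    qed
    show "linear (\<alpha> \<circ> \<phi>)"
    proof (rule linearI)
      fix x y :: "real^'k" and r
      show "(\<alpha> \<circ> \<phi>) (x + y) = (\<alpha> \<circ> \<phi>) x + (\<alpha> \<circ> \<phi>) y"
        using \<alpha>(1)[unfolded lin_on_def, rule_format, of "\<phi> x" "\<phi> y" 1 1] by (simp add: lin)
      show "(\<alpha> \<circ> \<phi>) (r *\<^sub>R x) = r *\<^sub>R (\<alpha> \<circ> \<phi>) x"
        using \<alpha>(1)[unfolded lin_on_def, rule_format, of "\<phi> x" "\<phi> x" r 0] by (simp add: lin)
    qed
    fix u assume u: "\<And>v. (\<alpha> \<circ> \<phi>) (br u v) = 0"
    show "u = 0"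
    proof (rule eqI)
      have "coboundary L \<alpha> (\<phi> u) v = 0" if "v \<in> lcarrier L" for v
      proof -
        obtain w where "v = \<phi> w" using \<phi>(3) \<open>v \<in> _\<close> by blast
        then show ?thesis using u[of w]
          by (simp add: coboundary_def \<phi>_br)
      qed
      then show "\<phi> u = \<phi> 0" using \<alpha>(2) by (simp add: lin)
    qed
  qed
  moreover have "L \<cong>\<^sub>L \<lparr>lcarrier = UNIV, lbracket = br\<rparr>"
    by (rule lie_iso_linear_symI[of \<phi>]) (use \<phi> in \<open>auto simp: \<phi>_br\<close>)
  ultimately show thesis by (rule that)
qed

section \<open>The principal element\<close>

locale commutative_algebra =
  fixes m :: "'v::euclidean_space \<Rightarrow> 'v \<Rightarrow> 'v" (infixl "\<star>" 70) and one :: 'v ("\<one>")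
  assumes bilinear: "bilinear (\<star>)" and commute: "x \<star> y = y \<star> x"
    and assoc: "x \<star> y \<star> z = x \<star> (y \<star> z)" and unit: "\<one> \<star> x = x"

context frobenius_bracket
begin

lemmas br_simps = bilinear_ladd[OF bilinear] bilinear_radd[OF bilinear]
  bilinear_lmul[OF bilinear] bilinear_rmul[OF bilinear] bilinear_lzero[OF bilinear]
  bilinear_rzero[OF bilinear] bilinear_lneg[OF bilinear] bilinear_rneg[OF bilinear]
  bilinear_lsub[OF bilinear] bilinear_rsub[OF bilinear]

lemmas functional_simps = linear_add[OF linear_functional] linear_scale[OF linear_functional]
  linear_0[OF linear_functional] linear_neg[OF linear_functional]
  linear_diff[OF linear_functional]

lemma antisym: "br x y = - br y x"
proof -
  have "br x y + br y x = br (x + y) (x + y)"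
    by (simp add: br_simps alternating[of x] alternating[of y])
  then show ?thesis by (simp add: alternating eq_neg_iff_add_eq_0)
qed

lemma derivation: "br x (br y z) = br (br x y) z + br y (br x z)"
proof -
  have "br x (br y z) - br y (br x z) - br (br x y) z = 0"
    using jacobi[of x y z] antisym[of z x] antisym[of z "br x y"] by (simp add: br_simps)
  then show ?thesis by (simp add: algebra_simps)
qed

text \<open>The vector \<open>h u\<close> holds the values of \<alpha> [u, -] on the standard basis.
  Nondegeneracy makes the endomorphism \<open>h\<close> injective, hence surjective.\<close>

lemma functional_represented:
  assumes "linear f"
  obtains u where "\<And>v. \<alpha> (br u v) = f v"
proof -
  have lin: "linear (\<lambda>v. \<alpha> (br u v))" "linear (\<lambda>v. \<alpha> (br v u))" for u
    by (rule linearI; simp add: br_simps functional_simps)+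
  define h where "h u = (\<Sum>b\<in>Basis. \<alpha> (br u b) *\<^sub>R b)" for u
  have h: "h u \<bullet> b = \<alpha> (br u b)" if "b \<in> Basis" for u b
    using that by (simp add: h_def inner_sum_left inner_Basis if_distrib cong: if_cong)
  have lin_h: "linear h"
    unfolding h_def
    by (rule linearI)
      (simp_all add: br_simps functional_simps scaleR_add_left sum.distrib scaleR_sum_right)
  have "u = 0" if "h u = 0" for u
  proof (rule nondegenerate)
    have "(\<lambda>v. \<alpha> (br u v)) = (\<lambda>v. 0)"
      by (rule linear_eq_stdbasis[OF lin(1)]) (use h[of _ u] that in \<open>auto intro: linear_zero\<close>)
    then show "\<alpha> (br u v) = 0" for v by meson
  qed
  then have "surj h"
    by (intro linear_injective_imp_surjective lin_h) (simp_all add: linear_injective_0[OF lin_h])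
  then obtain u where u: "h u = (\<Sum>b\<in>Basis. f b *\<^sub>R b)" by (metis surjD)
  have "(\<lambda>v. \<alpha> (br u v)) = f"
  proof (rule linear_eq_stdbasis[OF lin(1) assms])
    fix b :: 'v assume "b \<in> Basis"
    then show "\<alpha> (br u b) = f b"
      using h[of b u] by (simp add: u inner_sum_left inner_Basis if_distrib cong: if_cong)
  qed
  then have "\<alpha> (br u v) = f v" for v by meson
  then show thesis by (rule that)
qed

text \<open>The principal element of the Frobenius functional \<alpha>. Nondegeneracy makes it
  unique, so the choice is harmless.\<close>

definition principal :: 'v where
  "principal = (SOME e. \<forall>v. \<alpha> (br e v) = \<alpha> v)"

lemma principal: "\<alpha> (br principal v) = \<alpha> v"
proof -
  have "\<exists>e. \<forall>v. \<alpha> (br e v) = \<alpha> v"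
    using functional_represented[OF linear_functional] by metis
  then show ?thesis unfolding principal_def by (rule someI2_ex) blast
qed

text \<open>
  With respect to the form, \<open>ad principal\<close> and its adjoint add up to the identity, so
  \<open>ad principal\<close> fixes every vector that is orthogonal to all brackets.
\<close>

lemma principal_bracket: "br principal (br x y) = br x y"
proof -
  define c where "c = br x y"
  have "c - br principal c = 0"
  proof (rule nondegenerate)
    fix u
    have "\<alpha> (br u c) = \<alpha> (br principal (br u c))"
      by (rule principal[symmetric])
    \<comment> \<open>The remaining term \<open>br (br principal u) c\<close> of the derivation rule
      is a bracket of two brackets, as \<open>c\<close> is one.\<close>
    also have "br principal (br u c) = br u (br principal c)"
      using derivation[of principal u c] by (simp add: c_def two_step)
    finally have "\<alpha> (br u (c - br principal c)) = 0"
      by (simp add: br_simps functional_simps)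
    then show "\<alpha> (br (c - br principal c) u) = 0"
      using antisym[of u "c - br principal c"] by (simp add: functional_simps)
  qed
  then show ?thesis by (simp add: c_def)
qed

text \<open>\<open>fixed\<close> and \<open>cent\<close> are the eigenspaces of
  \<open>br principal\<close> for 1 and 0. Every bracket lies in \<open>fixed\<close>, and every
  vector of \<open>fixed\<close> is a bracket with \<open>principal\<close>, so \<open>fixed\<close>
  is the derived algebra.\<close>

definition fixed :: "'v set" where "fixed = {v. br principal v = v}"

definition cent :: "'v set" where "cent = {v. br principal v = 0}"

lemma fixed_bracket: "br x y \<in> fixed"
  by (simp add: fixed_def principal_bracket)

lemma fixed_abelian: "x \<in> fixed \<Longrightarrow> y \<in> fixed \<Longrightarrow> br x y = 0"
  unfolding fixed_def using two_step[of principal x principal y] by simp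

text \<open>By the derivation rule \<open>principal\<close> kills the bracket of two elements that
  it kills; but it also fixes every bracket.\<close>

lemma cent_abelian:
  assumes "x \<in> cent" and "y \<in> cent"
  shows "br x y = 0"
  using derivation[of principal x y] principal_bracket[of x y] assms
  by (simp add: cent_def br_simps)

text \<open>Yields the splitting of v into v - [e, v] in \<open>cent\<close> and [e, v] in
  \<open>fixed\<close>, with e = \<open>principal\<close>.\<close>

lemma diff_cent: "v - br principal v \<in> cent"
  by (simp add: cent_def br_simps principal_bracket)

lemma cent_commute: "x \<in> cent \<Longrightarrow> y \<in> cent \<Longrightarrow> br x (br y v) = br y (br x v)"
  using derivation[of x y v] by (simp add: cent_abelian br_simps)

lemma principal_cent: "principal \<in> cent"
  by (simp add: cent_def alternating)

lemma subspace_cent: "subspace cent"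
  by (rule subspaceI) (simp_all add: cent_def br_simps)

lemma subspace_fixed: "subspace fixed"
  by (rule subspaceI) (simp_all add: fixed_def br_simps)

text \<open>Since \<open>fixed\<close> is isotropic for the form, pairing with the whole space
  reduces to pairing with \<open>cent\<close>. The companion \<open>cent_eq_0\<close> uses that
  \<open>cent\<close> is isotropic as well; together they make the pairing of \<open>cent\<close>
  with \<open>fixed\<close> perfect.\<close>

lemma fixed_eq_0:
  assumes "w \<in> fixed" and "\<And>z. z \<in> cent \<Longrightarrow> \<alpha> (br z w) = 0"
  shows "w = 0"
proof (rule nondegenerate)
  fix v
  have "br w v = br w (v - br principal v)"
    using assms(1) by (simp add: br_simps fixed_abelian fixed_bracket)
  then show "\<alpha> (br w v) = 0"
    using assms(2)[OF diff_cent[of v]] antisym[of w "v - br principal v"]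
    by (simp add: functional_simps)
qed

lemma cent_eq_0:
  assumes "b \<in> cent" and "\<And>d. d \<in> fixed \<Longrightarrow> \<alpha> (br b d) = 0"
  shows "b = 0"
proof (rule nondegenerate)
  fix v
  have "br b v = br b (v - br principal v) + br b (br principal v)"
    by (simp add: br_simps)
  then show "\<alpha> (br b v) = 0"
    using assms by (simp add: cent_abelian diff_cent fixed_bracket)
qed

text \<open>The element a is chosen so that [b, [c, d]] and [a, d] agree after \<alpha>. As
  everything in sight commutes with \<open>br z\<close> for z in \<open>cent\<close>, applying this
  at [z, d] in place of d shows that the difference pairs to zero with all of
  \<open>cent\<close>.\<close>

lemma cent_product_ex:
  assumes "b \<in> cent" and "c \<in> cent"
  shows "\<exists>a\<in>cent. \<forall>d\<in>fixed. br b (br c d) = br a d"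
proof -
  have "linear (\<lambda>v. \<alpha> (br b (br c v)))"
    by (rule linearI) (simp_all add: br_simps functional_simps)
  then obtain u where u: "\<And>v. \<alpha> (br u v) = \<alpha> (br b (br c v))"
    by (rule functional_represented) blast
  \<comment> \<open>The part of u removed here lies in \<open>fixed\<close> and acts on
    \<open>fixed\<close> as zero.\<close>
  define a where "a = u - br principal u"
  have a: "a \<in> cent" by (simp add: a_def diff_cent)
  have pair: "\<alpha> (br a d) = \<alpha> (br b (br c d))" if "d \<in> fixed" for d
    using u[of d] that by (simp add: a_def br_simps functional_simps fixed_abelian fixed_bracket)
  have "br b (br c d) - br a d = 0" if "d \<in> fixed" for d
  proof (rule fixed_eq_0)
    show "br b (br c d) - br a d \<in> fixed"
      by (intro subspace_diff subspace_fixed fixed_bracket)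
    fix z assume z: "z \<in> cent"
    have "br z (br b (br c d)) = br b (br c (br z d))"
      using z assms by (simp add: cent_commute[of z])
    moreover have "br z (br a d) = br a (br z d)"
      using z a by (simp add: cent_commute)
    ultimately show "\<alpha> (br z (br b (br c d) - br a d)) = 0"
      using pair[OF fixed_bracket[of z d]] by (simp add: br_simps functional_simps)
  qed
  then show ?thesis using a by auto
qed

text \<open>The coordinates \<phi> on \<open>cent\<close> are arbitrary; those on
  \<open>fixed\<close>, given by \<open>P\<close> and its inverse \<theta>, are dual to them under
  the perfect pairing. In these coordinates \<open>cent\<close> acts on \<open>fixed\<close> by the
  transposes of multiplication, that is, by the coregular representation.\<close>

lemma presentation:
  assumes dim: "dim cent = CARD('n::finite)"
  obtains m :: "real^'n \<Rightarrow> real^'n \<Rightarrow> real^'n" and one and F :: "(real^'n) \<times> (real^'n) \<Rightarrow> 'v"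
  where "commutative_algebra m one" "linear F" "bij F"
    "\<And>x d x' d'. br (F (x, d)) (F (x', d')) = F (0, adjoint (m x) d' - adjoint (m x') d)"
proof -
  obtain \<phi> :: "real^'n \<Rightarrow> 'v" where \<phi>: "linear \<phi>" "inj \<phi>" "range \<phi> = cent"
    using subspace_coordinates[OF subspace_cent dim] .
  note \<phi>_simps = linear_add[OF \<phi>(1)] linear_scale[OF \<phi>(1)] linear_0[OF \<phi>(1)]
    linear_diff[OF \<phi>(1)]
  have cent [simp]: "\<phi> x \<in> cent" for x using \<phi>(3) by blast
  have "\<exists>z. \<forall>d\<in>fixed. br (\<phi> x) (br (\<phi> y) d) = br (\<phi> z) d" for x y
  proof -
    obtain a where "a \<in> cent" "\<forall>d\<in>fixed. br (\<phi> x) (br (\<phi> y) d) = br a d"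
      using cent_product_ex[OF cent[of x] cent[of y]] by blast
    then show ?thesis using \<phi>(3) by (metis rangeE)
  qed
  then obtain m where m: "\<And>x y d. d \<in> fixed \<Longrightarrow> br (\<phi> x) (br (\<phi> y) d) = br (\<phi> (m x y)) d"
    by metis
  \<comment> \<open>\<open>cent\<close> acts faithfully on \<open>fixed\<close>, so each algebra law
    below is an identity between operators, where associativity is automatic.\<close>
  have eqI: "x = y" if "\<And>d. d \<in> fixed \<Longrightarrow> br (\<phi> x) d = br (\<phi> y) d" for x y
  proof -
    have "\<phi> (x - y) = 0"
      by (rule cent_eq_0) (simp_all add: \<phi>_simps br_simps functional_simps that
        subspace_diff[OF subspace_cent])
    then show ?thesis using linear_injective_0[OF \<phi>(1)] \<phi>(2) by fastforce
  qed
  obtain one where one: "\<phi> one = principal" using \<phi>(3) principal_cent by (metis rangeE)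
  have alg: "commutative_algebra m one"
  proof
    show "bilinear m"
      unfolding bilinear_def
      by (intro conjI allI linearI; rule eqI)
        (simp_all add: m[symmetric] \<phi>_simps br_simps fixed_bracket)
    show "m x y = m y x" for x y
      by (rule eqI) (simp add: m[symmetric] cent_commute[of "\<phi> x" "\<phi> y"])
    show "m (m x y) z = m x (m y z)" for x y z
      by (rule eqI) (simp add: m[symmetric] fixed_bracket)
    show "m one x = x" for x
      by (rule eqI) (simp add: m[symmetric] one principal_bracket)
  qed
  interpret A: commutative_algebra m one by fact
  \<comment> \<open>\<open>P d\<close> represents the functional y \<mapsto> \<alpha> [\<phi> y, d]
    in the standard inner product.\<close>
  define P where "P d = (\<chi> i. \<alpha> (br (\<phi> (axis i 1)) d))" for d
  have lin_P: "linear P"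
    unfolding P_def by (rule linearI) (simp_all add: vec_eq_iff br_simps functional_simps)
  have P: "P d \<bullet> y = \<alpha> (br (\<phi> y) d)" for d y
  proof -
    have "(\<lambda>y. P d \<bullet> y) = (\<lambda>y. \<alpha> (br (\<phi> y) d))"
    proof (rule linear_eq_stdbasis)
      show "linear ((\<bullet>) (P d))"
        by (rule linearI) (simp_all add: inner_add_right)
      show "linear (\<lambda>y. \<alpha> (br (\<phi> y) d))"
        by (rule linearI) (simp_all add: br_simps functional_simps \<phi>_simps)
      fix b :: "real^'n" assume "b \<in> Basis"
      then obtain i where "b = axis i 1" by (auto simp: Basis_vec_def)
      then show "P d \<bullet> b = \<alpha> (br (\<phi> b) d)" by (simp add: P_def inner_axis)
    qed
    then show ?thesis by meson
  qed
  have inj_P: "inj_on P fixed"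
  proof (subst linear_injective_on_subspace_0[OF lin_P subspace_fixed], intro ballI impI)
    fix d assume d: "d \<in> fixed" "P d = 0"
    show "d = 0"
    proof (rule fixed_eq_0[OF d(1)])
      fix z assume "z \<in> cent"
      then obtain y where "z = \<phi> y" using \<phi>(3) by blast
      then show "\<alpha> (br z d) = 0" using P[of d y] d(2) by simp
    qed
  qed
  have sub: "subspace (P ` fixed)"
    by (rule linear_subspace_image[OF lin_P subspace_fixed])
  have surj_P: "P ` fixed = UNIV"
  proof (rule ccontr)
    assume "P ` fixed \<noteq> UNIV"
    then have "span (P ` fixed) \<noteq> UNIV" unfolding span_eq_iff[THEN iffD2, OF sub] .
    then obtain y where y: "y \<noteq> 0" "\<And>x. x \<in> span (P ` fixed) \<Longrightarrow> y \<bullet> x = 0"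
      using span_not_UNIV_orthogonal[of "P ` fixed"] by auto
    \<comment> \<open>A vector orthogonal to the image of \<open>P\<close> is an element of
      \<open>cent\<close> that pairs to zero with all of \<open>fixed\<close>.\<close>
    have "\<phi> y = 0"
    proof (rule cent_eq_0)
      fix d assume "d \<in> fixed"
      then have "y \<bullet> P d = 0" by (intro y span_base) simp
      then show "\<alpha> (br (\<phi> y) d) = 0" using P[of d y] by (simp add: inner_commute)
    qed simp
    then show False using linear_injective_0[OF \<phi>(1)] \<phi>(2) y(1) by simp
  qed
  obtain \<theta> where \<theta>: "linear \<theta>" "\<And>y. \<theta> y \<in> fixed" "\<And>y. P (\<theta> y) = y" "\<And>d. d \<in> fixed \<Longrightarrow> \<theta> (P d) = d"
  proof
    show mem: "inv_into fixed P y \<in> fixed" for y by (simp add: inv_into_into surj_P)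
    show P_inv: "P (inv_into fixed P y) = y" for y by (simp add: f_inv_into_f surj_P)
    show inv_P: "inv_into fixed P (P d) = d" if "d \<in> fixed" for d using inj_P that by simp
    show "linear (inv_into fixed P)"
    proof (rule linearI)
      fix x y r
      have "inv_into fixed P (P (inv_into fixed P x + inv_into fixed P y))
          = inv_into fixed P x + inv_into fixed P y"
        by (intro inv_P subspace_add[OF subspace_fixed] mem)
      then show "inv_into fixed P (x + y) = inv_into fixed P x + inv_into fixed P y"
        by (simp add: linear_add[OF lin_P] P_inv)
      have "inv_into fixed P (P (r *\<^sub>R inv_into fixed P x)) = r *\<^sub>R inv_into fixed P x"
        by (intro inv_P subspace_scale[OF subspace_fixed] mem)
      then show "inv_into fixed P (r *\<^sub>R x) = r *\<^sub>R inv_into fixed P x"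
        by (simp add: linear_scale[OF lin_P] P_inv)
    qed
  qed
  note \<theta>_simps = linear_add[OF \<theta>(1)] linear_scale[OF \<theta>(1)] linear_0[OF \<theta>(1)]
    linear_diff[OF \<theta>(1)]
  have act: "br (\<phi> x) (\<theta> d) = \<theta> (adjoint (m x) d)" for x d
  proof -
    have "P (br (\<phi> x) (\<theta> d)) \<bullet> y = adjoint (m x) d \<bullet> y" for y
    proof -
      have "P (br (\<phi> x) (\<theta> d)) \<bullet> y = \<alpha> (br (\<phi> (m y x)) (\<theta> d))"
        by (simp add: P m[symmetric] \<theta>)
      also have "\<dots> = d \<bullet> m y x" using P[of "\<theta> d" "m y x"] by (simp add: \<theta>)
      also have "\<dots> = d \<bullet> m x y" by (simp add: A.commute[of y])
      also have "\<dots> = adjoint (m x) d \<bullet> y"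
        using adjoint_works[of "m x" y d] A.bilinear by (simp add: inner_commute bilinear_def)
      finally show ?thesis .
    qed
    then have "P (br (\<phi> x) (\<theta> d)) = adjoint (m x) d" by (rule vector_eq_rdot[THEN iffD1, rule_format])
    then show ?thesis using \<theta>(4)[OF fixed_bracket[of "\<phi> x" "\<theta> d"]] by simp
  qed
  define F where "F = (\<lambda>(x, d). \<phi> x + \<theta> d)"
  have lin_F: "linear F"
    unfolding F_def by (rule linearI) (auto simp: \<phi>_simps \<theta>_simps scaleR_add_right)
  moreover have "bij F"
  proof (rule bijI)
    have "p = 0" if "F p = 0" for p
    proof -
      obtain x d where p: "p = (x, d)" by (cases p)
      have 0: "\<phi> x + \<theta> d = 0" using that by (simp add: p F_def)
      \<comment> \<open>Applying \<open>br principal\<close> kills the component in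
        \<open>cent\<close> and keeps the one in \<open>fixed\<close>.\<close>
      then have "br principal (\<phi> x + \<theta> d) = 0" by (simp add: br_simps)
      then have "\<theta> d = 0"
        using cent[of x] \<theta>(2)[of d] by (simp add: br_simps cent_def fixed_def)
      then have "d = 0" using \<theta>(3)[of d] by (simp add: linear_0[OF lin_P])
      moreover have "x = 0" using 0 \<open>\<theta> d = 0\<close> linear_injective_0[OF \<phi>(1)] \<phi>(2) by simp
      ultimately show ?thesis by (simp add: p zero_prod_def)
    qed
    then show "inj F" by (simp add: linear_injective_0[OF lin_F])
    have "\<exists>p. v = F p" for v
    proof -
      obtain x where "v - br principal v = \<phi> x" using diff_cent[of v] \<phi>(3) by blast
      then have "v = F (x, P (br principal v))"
        by (simp add: F_def \<theta>(4) fixed_bracket algebra_simps)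
      then show ?thesis by blast
    qed
    then show "surj F" by (auto simp: surj_def)
  qed
  moreover have "br (F (x, d)) (F (x', d')) = F (0, adjoint (m x) d' - adjoint (m x') d)"
    for x d x' d'
    using antisym[of "\<theta> d" "\<phi> x'"]
    by (simp add: F_def br_simps cent_abelian act fixed_abelian \<theta>(2) \<phi>_simps \<theta>_simps)
  ultimately show thesis using alg that by blast
qed

text \<open>The map F identifies the space with two copies of R^n. This excludes odd dimensions and
  turns the bound 6 on the Lie algebra into the bound 3 on the commutative algebra.\<close>

lemma DIM_eq_2_dim_cent:
  assumes "dim cent = CARD('n::finite)"
  shows "DIM('v) = 2 * CARD('n)"
proof -
  obtain m one and F :: "(real^'n) \<times> (real^'n) \<Rightarrow> 'v" where "linear F" "bij F"
    using presentation[where 'n='n, OF assms] by metis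
  then have "dim (UNIV :: ((real^'n) \<times> (real^'n)) set) = dim (F ` UNIV)"
    by (metis dim_image_eq bij_is_inj inj_on_subset top_greatest)
  then show ?thesis using \<open>bij F\<close> by (simp add: bij_is_surj)
qed

end

section \<open>Commutative algebras of dimension at most three\<close>

text \<open>Independence of a tuple instead of a set: repetitions count as dependence, and relations
  are compared coefficient by coefficient.\<close>

definition ind2 :: "'v::real_vector \<Rightarrow> 'v \<Rightarrow> bool" where
  "ind2 x y \<longleftrightarrow> (\<forall>r s. r *\<^sub>R x + s *\<^sub>R y = 0 \<longrightarrow> r = 0 \<and> s = 0)"

definition ind3 :: "'v::real_vector \<Rightarrow> 'v \<Rightarrow> 'v \<Rightarrow> bool" where
  "ind3 x y z \<longleftrightarrow>
     (\<forall>r s t. r *\<^sub>R x + s *\<^sub>R y + t *\<^sub>R z = 0 \<longrightarrow> r = 0 \<and> s = 0 \<and> t = 0)"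

definition comb2 :: "'v::real_vector \<Rightarrow> 'v \<Rightarrow> real^2 \<Rightarrow> 'v" where
  "comb2 x y w = w $ 1 *\<^sub>R x + w $ 2 *\<^sub>R y"

definition comb3 :: "'v::real_vector \<Rightarrow> 'v \<Rightarrow> 'v \<Rightarrow> real^3 \<Rightarrow> 'v" where
  "comb3 x y z w = w $ 1 *\<^sub>R x + w $ 2 *\<^sub>R y + w $ 3 *\<^sub>R z"

lemma linear_comb2: "linear (comb2 x y)"
  by (rule linearI) (simp_all add: comb2_def algebra_simps)

lemma linear_comb3: "linear (comb3 x y z)"
  by (rule linearI) (simp_all add: comb3_def algebra_simps)

lemma bij_comb2:
  fixes x y :: "'v::euclidean_space"
  assumes "DIM('v) = 2" and "ind2 x y"
  shows "bij (comb2 x y)"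
proof -
  have "w = 0" if "comb2 x y w = 0" for w
    using that assms(2) by (auto simp: comb2_def ind2_def vec_eq_iff forall_2)
  then have "inj (comb2 x y)" by (simp add: linear_injective_0[OF linear_comb2])
  then show ?thesis
    using linear_injective_imp_surjective[OF linear_comb2] assms(1) by (simp add: bij_def)
qed

lemma bij_comb3:
  fixes x y z :: "'v::euclidean_space"
  assumes "DIM('v) = 3" and "ind3 x y z"
  shows "bij (comb3 x y z)"
proof -
  have "w = 0" if "comb3 x y z w = 0" for w
    using that assms(2) by (auto simp: comb3_def ind3_def vec_eq_iff forall_3)
  then have "inj (comb3 x y z)" by (simp add: linear_injective_0[OF linear_comb3])
  then show ?thesis
    using linear_injective_imp_surjective[OF linear_comb3] assms(1) by (simp add: bij_def)
qed

lemma ind2_span: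
  fixes x y :: "'v::euclidean_space"
  assumes "DIM('v) = 2" and "ind2 x y"
  obtains r s where "v = r *\<^sub>R x + s *\<^sub>R y"
  using bij_comb2[OF assms] unfolding bij_def surj_def comb2_def by metis

lemma ind3_span:
  fixes x y z :: "'v::euclidean_space"
  assumes "DIM('v) = 3" and "ind3 x y z"
  obtains r s t where "v = r *\<^sub>R x + s *\<^sub>R y + t *\<^sub>R z"
  using bij_comb3[OF assms] unfolding bij_def surj_def comb3_def by metis

lemma in_span2: "z \<in> span {x, y} \<longleftrightarrow> (\<exists>r s. z = r *\<^sub>R x + s *\<^sub>R y)"
  by (auto simp: span_breakdown_eq algebra_simps)

lemma ind2_extend:
  assumes "x \<noteq> 0" and "y \<notin> span {x}"
  shows "ind2 x y"
  unfolding ind2_def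
proof (intro allI impI)
  fix r s assume eq: "r *\<^sub>R x + s *\<^sub>R y = 0"
  have "s = 0"
  proof (rule ccontr)
    assume "s \<noteq> 0"
    then have "y = (1 / s) *\<^sub>R (s *\<^sub>R y)" by simp
    also have "s *\<^sub>R y = - (r *\<^sub>R x)" using eq by (metis add_eq_0_iff)
    finally have "y = (- r / s) *\<^sub>R x" by simp
    then show False using assms(2) by (metis span_base span_scale singletonI)
  qed
  then show "r = 0 \<and> s = 0" using eq assms(1) by simp
qed

lemma ind3_extend:
  assumes "ind2 x y" and "z \<notin> span {x, y}"
  shows "ind3 x y z"
  unfolding ind3_def
proof (intro allI impI)
  fix r s t assume eq: "r *\<^sub>R x + s *\<^sub>R y + t *\<^sub>R z = 0"
  have "t = 0"
  proof (rule ccontr)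
    assume "t \<noteq> 0"
    then have "z = (1 / t) *\<^sub>R (t *\<^sub>R z)" by simp
    also have "t *\<^sub>R z = - (r *\<^sub>R x + s *\<^sub>R y)" using eq by (metis add_eq_0_iff)
    finally have "z = (- r / t) *\<^sub>R x + (- s / t) *\<^sub>R y"
      by (simp add: algebra_simps)
    then show False using assms(2) in_span2 by blast
  qed
  then show "r = 0 \<and> s = 0 \<and> t = 0" using eq assms(1) by (simp add: ind2_def)
qed

lemma exists_not_in_span:
  fixes xs :: "'v::euclidean_space list"
  assumes "length xs < DIM('v)"
  obtains z where "z \<notin> span (set xs)"
proof -
  have "dim (span (set xs)) < DIM('v)"
    using assms dim_le_card'[of "set xs"] card_length[of xs] by simp
  then have "span (set xs) \<noteq> UNIV" by (metis dim_UNIV less_irrefl)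
  then show thesis using that by blast
qed

text \<open>Intermediate value theorem on [-M, M]. As M \<ge> 1, the lower terms are at most (|p| +
  |q| + |r|) M^2 in absolute value, and M exceeds the sum in parentheses, so the cubic term decides
  the sign at both ends.\<close>

lemma cubic_root:
  fixes p q r :: real
  obtains s where "s ^ 3 = p + q * s + r * s\<^sup>2"
proof -
  define f where "f s = s ^ 3 - (p + q * s + r * s\<^sup>2)" for s :: real
  define M where "M = 1 + \<bar>p\<bar> + \<bar>q\<bar> + \<bar>r\<bar>"
  have M: "M \<ge> 1" by (simp add: M_def)
  have bound: "\<bar>p\<bar> + \<bar>q\<bar> * M + \<bar>r\<bar> * M\<^sup>2 \<le> M ^ 3"
  proof -
    have "M \<le> M\<^sup>2" "1 \<le> M\<^sup>2" using M power_increasing[of 1 2 M] one_le_power[of M 2] by simp_all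
    then have "\<bar>p\<bar> + \<bar>q\<bar> * M + \<bar>r\<bar> * M\<^sup>2 \<le> \<bar>p\<bar> * M\<^sup>2 + \<bar>q\<bar> * M\<^sup>2 + \<bar>r\<bar> * M\<^sup>2"
      by (intro add_mono mult_left_mono order_refl) (simp_all add: mult_le_cancel_left1)
    also have "\<dots> \<le> M * M\<^sup>2"
      by (simp add: M_def algebra_simps)
    finally show ?thesis by (simp add: power3_eq_cube power2_eq_square)
  qed
  have ab: "\<bar>q * M\<bar> = \<bar>q\<bar> * M" "\<bar>r * M\<^sup>2\<bar> = \<bar>r\<bar> * M\<^sup>2" using M by (simp_all add: abs_mult)
  have "f (- M) \<le> 0" "0 \<le> f M"
    using bound ab unfolding f_def by (simp_all add: power3_eq_cube power2_eq_square)
  moreover have "continuous_on {- M..M} f" unfolding f_def by (intro continuous_intros)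
  ultimately obtain s where "f s = 0"
    using IVT'[of f "- M" 0 M] M by auto
  then show thesis using that by (simp add: f_def)
qed

section \<open>Quadratic elements, idempotents and nilpotents of a commutative algebra\<close>

context commutative_algebra
begin

lemma left_commute: "x \<star> (y \<star> z) = y \<star> (x \<star> z)"
  by (metis assoc commute)

lemma unit_right: "x \<star> \<one> = x"
  using unit commute by metis

lemmas mult_simps = bilinear_ladd[OF bilinear] bilinear_radd[OF bilinear]
  bilinear_lmul[OF bilinear] bilinear_rmul[OF bilinear] bilinear_lzero[OF bilinear]
  bilinear_rzero[OF bilinear] bilinear_lneg[OF bilinear] bilinear_rneg[OF bilinear]
  bilinear_lsub[OF bilinear] bilinear_rsub[OF bilinear] unit unit_right

lemma unit_nonzero: "\<one> \<noteq> 0"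
proof
  assume "\<one> = 0"
  then have "x = 0" for x :: 'v using unit[of x] by (simp add: mult_simps)
  then show False using nonempty_Basis nonzero_Basis by blast
qed

text \<open>Completing the square: (y - (q/2) g)^2 is r g, where r is a quarter of the discriminant,
  and scaling by 1 / sqrt |r| normalizes a nonzero r to a sign. The idempotent g need only act as a
  unit on y, so that the lemma applies to the whole algebra and to a direct factor alike.\<close>

lemma quadratic_normal_form:
  assumes "g \<star> g = g" and "g \<star> y = y" and yy: "y \<star> y = p *\<^sub>R g + q *\<^sub>R y"
  obtains s t z where "s \<noteq> 0" "z = s *\<^sub>R y + t *\<^sub>R g" "z \<star> z = 0 \<or> z \<star> z = g \<or> z \<star> z = - g"
proof -
  define r where "r = p + q\<^sup>2 / 4"
  define z where "z s = s *\<^sub>R y + (- s * q / 2) *\<^sub>R g" for s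
  have "y \<star> g = y" using assms(2) by (simp add: commute)
  then have "z s \<star> z s = (s * s) *\<^sub>R (y \<star> y) + (- s * s * q) *\<^sub>R y + (s * s * q * q / 4) *\<^sub>R g" for s
    by (simp add: z_def mult_simps assms(1,2) algebra_simps flip: scaleR_add_left)
  then have zz: "z s \<star> z s = (s * s * r) *\<^sub>R g" for s
    by (simp add: yy r_def algebra_simps power2_eq_square)
  note result = that
  have *: thesis if "s \<noteq> 0" "s * s * r = 0 \<or> s * s * r = 1 \<or> s * s * r = - 1" for s
  proof (rule result[OF that(1) z_def])
    show "z s \<star> z s = 0 \<or> z s \<star> z s = g \<or> z s \<star> z s = - g"
      using that(2) zz[of s] by auto
  qed
  consider "r = 0" | "r > 0" | "r < 0" by linarith
  then show thesis
  proof cases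
    case 1 then show ?thesis using *[of 1] by simp
  next
    case 2 then show ?thesis using *[of "1 / sqrt r"] by simp
  next
    case 3 then show ?thesis using *[of "1 / sqrt (- r)"] by simp
  qed
qed

text \<open>The sign of the discriminant of a non-scalar element decides between R \<times> R,
  R[t]/(t^2) and C. If z^2 = 1, then (1 + z)/2 and (1 - z)/2 are complementary orthogonal
  idempotents.\<close>

lemma classification_2:
  assumes dim: "DIM('v) = 2"
  obtains x y where "ind2 x y" "x \<star> x = x" "y \<star> y = y" "x \<star> y = 0"
  | y where "ind2 \<one> y" "y \<star> y = 0"
  | y where "ind2 \<one> y" "y \<star> y = - \<one>"
proof -
  obtain x where "x \<notin> span {\<one>}" using exists_not_in_span[of "[\<one>]"] dim by auto
  then have ind: "ind2 \<one> x" by (intro ind2_extend unit_nonzero)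
  obtain p q where "x \<star> x = p *\<^sub>R \<one> + q *\<^sub>R x" using ind2_span[OF dim ind] .
  then obtain s t z where z: "s \<noteq> 0" "z = s *\<^sub>R x + t *\<^sub>R \<one>"
    and zz: "z \<star> z = 0 \<or> z \<star> z = \<one> \<or> z \<star> z = - \<one>"
    using quadratic_normal_form[of \<one> x p q] unit by metis
  have indz: "ind2 \<one> z"
    unfolding ind2_def
  proof (intro allI impI)
    fix a b assume "a *\<^sub>R \<one> + b *\<^sub>R z = 0"
    then have "(a + b * t) *\<^sub>R \<one> + (b * s) *\<^sub>R x = 0" by (simp add: z algebra_simps)
    then have "a + b * t = 0 \<and> b * s = 0" using ind unfolding ind2_def by blast
    then show "a = 0 \<and> b = 0" using z(1) by auto
  qed
  show thesis
    using zz
  proof (elim disjE)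
    assume zz: "z \<star> z = \<one>"
    show thesis
    proof (rule that(1))
      show "ind2 ((1 / 2) *\<^sub>R (\<one> + z)) ((1 / 2) *\<^sub>R (\<one> - z))"
        unfolding ind2_def
      proof (intro allI impI)
        fix a b assume "a *\<^sub>R (1 / 2) *\<^sub>R (\<one> + z) + b *\<^sub>R (1 / 2) *\<^sub>R (\<one> - z) = 0"
        then have "((a + b) / 2) *\<^sub>R \<one> + ((a - b) / 2) *\<^sub>R z = 0"
          by (simp add: algebra_simps add_divide_distrib diff_divide_distrib)
        then have "(a + b) / 2 = 0 \<and> (a - b) / 2 = 0" using indz unfolding ind2_def by blast
        then show "a = 0 \<and> b = 0" by simp
      qed
    qed (simp_all add: mult_simps zz algebra_simps flip: scaleR_add_left)
  qed (use that indz in blast)+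
qed

text \<open>Such a y would make the algebra a complex vector space of odd real dimension.
  Concretely, y acts on the line obtained by dividing out \<open>span {\<one>, y}\<close> as a real
  scalar c with c^2 = -1.\<close>

lemma no_complex_structure:
  assumes dim: "DIM('v) = 3"
  shows "y \<star> y \<noteq> - \<one>"
proof
  assume yy: "y \<star> y = - \<one>"
  have "y \<noteq> c *\<^sub>R \<one>" for c
  proof
    assume "y = c *\<^sub>R \<one>"
    then have "(c * c + 1) *\<^sub>R \<one> = 0" using yy by (simp add: mult_simps algebra_simps)
    then show False using unit_nonzero by (simp add: add_nonneg_eq_0_iff)
  qed
  then have "ind2 \<one> y"
    by (intro ind2_extend unit_nonzero) (auto simp: span_singleton)
  moreover obtain z where "z \<notin> span {\<one>, y}"
    using exists_not_in_span[of "[\<one>, y]"] dim by auto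
  ultimately have ind: "ind3 \<one> y z" by (rule ind3_extend)
  obtain a b c where yz: "y \<star> z = a *\<^sub>R \<one> + b *\<^sub>R y + c *\<^sub>R z" using ind3_span[OF dim ind] .
  have "- z = y \<star> (y \<star> z)" using yy by (simp add: mult_simps flip: assoc)
  also have "\<dots> = a *\<^sub>R y - b *\<^sub>R \<one> + c *\<^sub>R (y \<star> z)"
    by (subst yz) (simp add: mult_simps yy)
  finally have "(c * a - b) *\<^sub>R \<one> + (a + c * b) *\<^sub>R y + (c * c + 1) *\<^sub>R z = 0"
    by (simp add: yz algebra_simps eq_neg_iff_add_eq_0)
  then have "c * c + 1 = 0" using ind unfolding ind3_def by blast
  then show False by (metis le_add_same_cancel2 not_one_le_zero zero_le_square)
qed

text \<open>A product of algebras: z spans a factor R, and the plane of x and y is R \<times> R,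
  R[t]/(t^2) or C, in the order of the alternatives. In the last two, x is the unit of the
  plane.\<close>

definition idempotent_basis :: "'v \<Rightarrow> 'v \<Rightarrow> 'v \<Rightarrow> bool" where
  "idempotent_basis x y z \<longleftrightarrow> ind3 x y z \<and> x \<star> x = x \<and> z \<star> z = z \<and> x \<star> z = 0 \<and> y \<star> z = 0 \<and>
     (x \<star> y = 0 \<and> y \<star> y = y \<or> x \<star> y = y \<and> y \<star> y = 0 \<or> x \<star> y = y \<and> y \<star> y = - x)"

text \<open>The hypothesis \<open>primitive\<close> says that the factor with unit f is a line. The
  complementary factor has unit g = 1 - f and dimension 2, and \<open>quadratic_normal_form\<close>
  classifies it as in the two-dimensional case.\<close>

lemma primitive_idempotent_basis:
  assumes dim: "DIM('v) = 3" and ff: "f \<star> f = f" and f: "f \<noteq> 0" "f \<noteq> \<one>"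
    and primitive: "\<And>y. f \<star> y = y \<Longrightarrow> \<exists>c. y = c *\<^sub>R f"
  shows "\<exists>x y z. idempotent_basis x y z"
proof -
  define g where "g = \<one> - f"
  have gg: "g \<star> g = g" and gf: "g \<star> f = 0" and fg: "f \<star> g = 0" and g: "g \<noteq> 0"
    and g_eq: "f \<star> v + g \<star> v = v" for v
    using ff f by (simp_all add: g_def mult_simps)
  have ind: "ind2 f g"
    unfolding ind2_def
  proof (intro allI impI)
    fix r s assume eq: "r *\<^sub>R f + s *\<^sub>R g = 0"
    then have "f \<star> (r *\<^sub>R f + s *\<^sub>R g) = 0" by (simp add: mult_simps)
    then have "r = 0" using f by (simp add: mult_simps ff fg)
    then show "r = 0 \<and> s = 0" using eq g by simp
  qed
  obtain v where v: "v \<notin> span {f, g}" using exists_not_in_span[of "[f, g]"] dim by auto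
  define y where "y = g \<star> v"
  have gy: "g \<star> y = y" and fy: "f \<star> y = 0"
    by (simp_all add: y_def gg fg mult_simps flip: assoc)
  have "y \<notin> span {f, g}"
  proof
    assume y: "y \<in> span {f, g}"
    have "f \<star> (f \<star> v) = f \<star> v" by (simp add: ff flip: assoc)
    then obtain c where "f \<star> v = c *\<^sub>R f" using primitive by blast
    then have "f \<star> v \<in> span {f, g}" by (simp add: span_base span_scale)
    then have "f \<star> v + g \<star> v \<in> span {f, g}" using y by (simp add: y_def span_add)
    then show False using v g_eq by simp
  qed
  then have ind: "ind3 f g y" by (rule ind3_extend[OF ind])
  obtain r p q where yy: "y \<star> y = r *\<^sub>R f + p *\<^sub>R g + q *\<^sub>R y" using ind3_span[OF dim ind] .
  \<comment> \<open>The square stays in the factor of g; multiplying by g removes the coefficient r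
    of f.\<close>
  have "y \<star> y = g \<star> (y \<star> y)" by (simp add: gy flip: assoc)
  then have "y \<star> y = p *\<^sub>R g + q *\<^sub>R y"
    by (subst (asm) (2) yy) (simp add: mult_simps gf gg gy)
  then obtain s t z where z: "s \<noteq> 0" "z = s *\<^sub>R y + t *\<^sub>R g"
    and zz: "z \<star> z = 0 \<or> z \<star> z = g \<or> z \<star> z = - g"
    using quadratic_normal_form[OF gg gy] by metis
  have gz: "g \<star> z = z" and zg: "z \<star> g = z" and zf: "z \<star> f = 0"
    using commute[of f z] commute[of g z]
    by (simp_all add: z mult_simps gy gg fy fg commute[of y] commute[of g f])
  have indz: "ind3 g z f"
    unfolding ind3_def
  proof (intro allI impI)
    fix a b c assume "a *\<^sub>R g + b *\<^sub>R z + c *\<^sub>R f = 0"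
    then have "c *\<^sub>R f + (a + b * t) *\<^sub>R g + (b * s) *\<^sub>R y = 0" by (simp add: z algebra_simps)
    then have "c = 0 \<and> a + b * t = 0 \<and> b * s = 0" using ind unfolding ind3_def by blast
    then show "a = 0 \<and> b = 0 \<and> c = 0" using z(1) by auto
  qed
  show ?thesis
  proof (cases "z \<star> z = g")
    case True
    have "idempotent_basis ((1 / 2) *\<^sub>R (g + z)) ((1 / 2) *\<^sub>R (g - z)) f"
      unfolding idempotent_basis_def
    proof (intro conjI disjI1)
      show "ind3 ((1 / 2) *\<^sub>R (g + z)) ((1 / 2) *\<^sub>R (g - z)) f"
        unfolding ind3_def
      proof (intro allI impI)
        fix a b c assume "a *\<^sub>R (1 / 2) *\<^sub>R (g + z) + b *\<^sub>R (1 / 2) *\<^sub>R (g - z) + c *\<^sub>R f = 0"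
        then have "((a + b) / 2) *\<^sub>R g + ((a - b) / 2) *\<^sub>R z + c *\<^sub>R f = 0"
          by (simp add: algebra_simps add_divide_distrib diff_divide_distrib)
        then have "(a + b) / 2 = 0 \<and> (a - b) / 2 = 0 \<and> c = 0"
          using indz unfolding ind3_def by blast
        then show "a = 0 \<and> b = 0 \<and> c = 0" by simp
      qed
    qed (simp_all add: mult_simps True gg gz zg zf gf ff algebra_simps flip: scaleR_add_left)
    then show ?thesis by blast
  next
    case False
    then have "idempotent_basis g z f"
      using indz zz by (simp add: idempotent_basis_def gg gz zf gf ff)
    then show ?thesis by blast
  qed
qed

text \<open>The factors of f and 1 - f have dimensions adding up to 3, so one of them is a line: if
  the factor of f contains a further y, then f, y and 1 - f form a basis and only multiples of 1 - f
  are left for the other factor.\<close>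

lemma nontrivial_idempotent_basis:
  assumes dim: "DIM('v) = 3" and ff: "f \<star> f = f" and f: "f \<noteq> 0" "f \<noteq> \<one>"
  shows "\<exists>x y z. idempotent_basis x y z"
proof (cases "\<forall>y. f \<star> y = y \<longrightarrow> (\<exists>c. y = c *\<^sub>R f)")
  case True
  then show ?thesis using primitive_idempotent_basis[OF assms] by blast
next
  case False
  then obtain y where y: "f \<star> y = y" "\<And>c. y \<noteq> c *\<^sub>R f" by blast
  define g where "g = \<one> - f"
  have gg: "g \<star> g = g" and gf: "g \<star> f = 0" and g: "g \<noteq> 0" "g \<noteq> \<one>" and gy: "g \<star> y = 0"
    using ff f y(1) by (simp_all add: g_def mult_simps)
  have "ind2 f y"
    using y(2) by (intro ind2_extend f) (auto simp: span_singleton)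
  moreover have "g \<notin> span {f, y}"
    unfolding in_span2
  proof
    assume "\<exists>r s. g = r *\<^sub>R f + s *\<^sub>R y"
    then obtain r s where "g = r *\<^sub>R f + s *\<^sub>R y" by blast
    then have "g \<star> g = 0" using gf gy by (metis (no_types) bilinear bilinear_radd
      bilinear_rmul add.right_neutral scaleR_zero_right)
    then show False using gg g by simp
  qed
  ultimately have ind: "ind3 f y g" by (rule ind3_extend)
  have "\<exists>c. z = c *\<^sub>R g" if gz: "g \<star> z = z" for z
  proof -
    obtain r s t where z: "z = r *\<^sub>R f + s *\<^sub>R y + t *\<^sub>R g" using ind3_span[OF dim ind] .
    have "z = g \<star> z" using gz by simp
    also have "\<dots> = t *\<^sub>R g" by (simp add: z mult_simps gf gy gg)
    finally show ?thesis by blast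
  qed
  then show ?thesis by (rule primitive_idempotent_basis[OF dim gg g])
qed

text \<open>Without nontrivial idempotents the minimal polynomial of x is a power of one irreducible
  factor, which must be linear: a quadratic factor would produce a square root of -1, and a cubic
  has a real root.\<close>

lemma local_shift_nilpotent:
  assumes dim: "DIM('v) = 3"
    and local: "\<And>u. u \<star> u = u \<Longrightarrow> u = 0 \<or> u = \<one>"
  obtains s where "(x - s *\<^sub>R \<one>) \<star> ((x - s *\<^sub>R \<one>) \<star> (x - s *\<^sub>R \<one>)) = 0"
proof (cases "x \<in> span {\<one>}")
  case True
  then obtain c where "x = c *\<^sub>R \<one>" by (auto simp: span_singleton)
  then show thesis using that[of c] by (simp add: mult_simps)
next
  case False
  then have ind: "ind2 \<one> x" by (intro ind2_extend unit_nonzero)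
  show thesis
  proof (cases "x \<star> x \<in> span {\<one>, x}")
    case True
    then obtain p q where "x \<star> x = p *\<^sub>R \<one> + q *\<^sub>R x" using in_span2 by blast
    then obtain s t z where z: "s \<noteq> 0" "z = s *\<^sub>R x + t *\<^sub>R \<one>"
      and zz: "z \<star> z = 0 \<or> z \<star> z = \<one> \<or> z \<star> z = - \<one>"
      using quadratic_normal_form[of \<one> x p q] unit by metis
    have "z \<star> z \<noteq> \<one>"
    proof
      assume "z \<star> z = \<one>"
      then have "(1 / 2) *\<^sub>R (\<one> + z) \<star> ((1 / 2) *\<^sub>R (\<one> + z)) = (1 / 2) *\<^sub>R (\<one> + z)"
        by (simp add: mult_simps algebra_simps flip: scaleR_add_left)
      then consider "(1 / 2) *\<^sub>R (\<one> + z) = 0" | "(1 / 2) *\<^sub>R (\<one> + z) = \<one>" using local by blast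
      then have "\<exists>c. z = c *\<^sub>R \<one>"
      proof cases
        case 1
        then have "\<one> + z = 0" by simp
        then have "z = (- 1) *\<^sub>R \<one>" by (simp add: eq_neg_iff_add_eq_0 add.commute)
        then show ?thesis by blast
      next
        case 2
        then have "2 *\<^sub>R (1 / 2) *\<^sub>R (\<one> + z) = 2 *\<^sub>R \<one>" by simp
        then have "\<one> + z = \<one> + \<one>" by (simp add: scaleR_2)
        then have "z = 1 *\<^sub>R \<one>" by simp
        then show ?thesis by blast
      qed
      then obtain c where "z = c *\<^sub>R \<one>" by blast
      then have "(t - c) *\<^sub>R \<one> + s *\<^sub>R x = 0" by (simp add: z algebra_simps)
      then show False using ind z(1) unfolding ind2_def by blast
    qed
    then have zz: "z \<star> z = 0" using zz no_complex_structure[OF dim] by blast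
    have "x - (- t / s) *\<^sub>R \<one> = (1 / s) *\<^sub>R z" using z by (simp add: algebra_simps)
    then show ?thesis by (intro that[of "- t / s"]) (simp only:, simp add: mult_simps zz)
  next
    case False
    then have ind: "ind3 \<one> x (x \<star> x)" by (rule ind3_extend[OF ind])
    obtain p q r where x3: "x \<star> (x \<star> x) = p *\<^sub>R \<one> + q *\<^sub>R x + r *\<^sub>R (x \<star> x)"
      using ind3_span[OF dim ind] .
    obtain s where s: "s ^ 3 = p + q * s + r * s\<^sup>2" by (rule cubic_root)
    define y where "y = x - s *\<^sub>R \<one>"
    \<comment> \<open>Taylor expansion at s of the cubic f(t) = t^3 - r t^2 - q t - p annihilating
      x: f(s + t) = t (t^2 + b t + c), with b = f''(s)/2 and c = f'(s). Thus v is the cofactor of y,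
      nonzero because x \<star> x occurs in it with coefficient 1.\<close>
    define b where "b = s + s + s - r"
    define c where "c = s * s + s * s + s * s - r * s - r * s - q"
    define v where "v = y \<star> y + b *\<^sub>R y + c *\<^sub>R \<one>"
    have "(k * 3) *\<^sub>R w = k *\<^sub>R w + k *\<^sub>R w + k *\<^sub>R w"
      "(k * (l * 2)) *\<^sub>R w = (k * l) *\<^sub>R w + (k * l) *\<^sub>R w" for k l and w :: 'v
      by (simp_all flip: scaleR_add_left)
    then have v: "v = (s\<^sup>2 - r * s - q) *\<^sub>R \<one> + (s - r) *\<^sub>R x + 1 *\<^sub>R (x \<star> x)"
      by (simp add: v_def y_def b_def c_def mult_simps algebra_simps power2_eq_square)
    then have v0: "v \<noteq> 0" using ind unfolding ind3_def by (metis zero_neq_one)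
    have "y \<star> v = (p + q * s + r * s\<^sup>2 - s ^ 3) *\<^sub>R \<one>"
      by (simp add: v y_def mult_simps x3 algebra_simps power2_eq_square power3_eq_cube)
    then have yv: "y \<star> v = 0" by (simp add: s)
    have y0: "y \<noteq> 0" using \<open>x \<notin> span {\<one>}\<close> by (auto simp: y_def span_singleton)
    have y3: "y \<star> (y \<star> y) + b *\<^sub>R (y \<star> y) + c *\<^sub>R y = 0"
      using yv by (simp add: v_def mult_simps)
    have c: "c = 0"
    proof (rule ccontr)
      assume "c \<noteq> 0"
      \<comment> \<open>For c \<noteq> 0 the factors t and t^2 + b t + c are coprime. The idempotent
        that separates them is 1 - v/c, which is y \<star> w; were it 1, then y would be invertible
        and y \<star> v = 0 would give v = 0.\<close>
      define w where "w = (- 1 / c) *\<^sub>R (y + b *\<^sub>R \<one>)"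
      have "y \<star> (y \<star> w) = (- 1 / c) *\<^sub>R (y \<star> (y \<star> y) + b *\<^sub>R (y \<star> y))"
        by (simp add: w_def mult_simps)
      also have "y \<star> (y \<star> y) + b *\<^sub>R (y \<star> y) = - c *\<^sub>R y"
        using y3 by (simp add: eq_neg_iff_add_eq_0)
      finally have yyw: "y \<star> (y \<star> w) = y" using \<open>c \<noteq> 0\<close> by simp
      have "(y \<star> w) \<star> (y \<star> w) = (y \<star> (y \<star> w)) \<star> w" by (simp only: assoc commute left_commute)
      then have "(y \<star> w) \<star> (y \<star> w) = y \<star> w" by (simp only: yyw)
      moreover have "y \<star> w \<noteq> 0" using yyw y0 by (auto simp: mult_simps)
      ultimately have "y \<star> w = \<one>" using local by blast
      have "v = (y \<star> w) \<star> v" by (simp add: \<open>y \<star> w = \<one>\<close> mult_simps)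
      also have "\<dots> = w \<star> (y \<star> v)" by (simp only: assoc commute left_commute)
      finally show False using v0 by (simp add: yv mult_simps)
    qed
    have "y \<star> (y \<star> y) = 0"
    proof (cases "b = 0")
      case True
      then show ?thesis using y3 c by simp
    next
      case False
      have y3: "y \<star> (y \<star> y) = - b *\<^sub>R (y \<star> y)" using y3 c by (simp add: eq_neg_iff_add_eq_0)
      \<comment> \<open>Now the polynomial is t^2 (t + b) with b \<noteq> 0, and y^2 / b^2 is the
        idempotent separating these factors.\<close>
      define u where "u = (1 / b\<^sup>2) *\<^sub>R (y \<star> y)"
      have "(y \<star> y) \<star> (y \<star> y) = b\<^sup>2 *\<^sub>R (y \<star> y)"
        by (simp add: assoc y3 mult_simps power2_eq_square)
      then have "u \<star> u = u" using False by (simp add: u_def mult_simps)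
      moreover have "u \<noteq> \<one>"
      proof
        assume "u = \<one>"
        then have "v = u \<star> v" by (simp add: mult_simps)
        then have "v = (1 / b\<^sup>2) *\<^sub>R (y \<star> (y \<star> v))" by (simp add: u_def mult_simps assoc)
        then show False using v0 by (simp add: yv mult_simps)
      qed
      ultimately have "u = 0" using local by blast
      then show ?thesis using False by (simp add: u_def mult_simps)
    qed
    then show ?thesis using that[of s] by (simp add: y_def)
  qed
qed

text \<open>In the local case shifting two basis vectors yields a basis of 1 and two elements of
  cube zero. Either some element of cube zero has a nonzero square and generates R[t]/(t^3), or all
  of them square to zero.\<close>

lemma classification_3:
  assumes dim: "DIM('v) = 3"
  obtains x y z where "idempotent_basis x y z"
  | y z where "ind3 \<one> y z" "y \<star> y = z" "y \<star> z = 0" "z \<star> z = 0"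
  | y z where "ind3 \<one> y z" "y \<star> y = 0" "y \<star> z = 0" "z \<star> z = 0"
proof (cases "\<forall>u. u \<star> u = u \<longrightarrow> u = 0 \<or> u = \<one>")
  case False
  then show thesis using nontrivial_idempotent_basis[OF dim] that(1) by blast
next
  case True
  obtain x where "x \<notin> span {\<one>}" using exists_not_in_span[of "[\<one>]"] dim by auto
  then have "ind2 \<one> x" by (intro ind2_extend unit_nonzero)
  moreover obtain x' where "x' \<notin> span {\<one>, x}" using exists_not_in_span[of "[\<one>, x]"] dim by auto
  ultimately have ind: "ind3 \<one> x x'" by (rule ind3_extend)
  obtain s where s: "(x - s *\<^sub>R \<one>) \<star> ((x - s *\<^sub>R \<one>) \<star> (x - s *\<^sub>R \<one>)) = 0"
    using local_shift_nilpotent[OF dim] True by metis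
  obtain s' where s': "(x' - s' *\<^sub>R \<one>) \<star> ((x' - s' *\<^sub>R \<one>) \<star> (x' - s' *\<^sub>R \<one>)) = 0"
    using local_shift_nilpotent[OF dim] True by metis
  define y where "y = x - s *\<^sub>R \<one>"
  define z where "z = x' - s' *\<^sub>R \<one>"
  have y: "y \<star> (y \<star> y) = 0" and z: "z \<star> (z \<star> z) = 0" using s s' by (simp_all add: y_def z_def)
  have ind: "ind3 \<one> y z"
    unfolding ind3_def
  proof (intro allI impI)
    fix a b c assume "a *\<^sub>R \<one> + b *\<^sub>R y + c *\<^sub>R z = 0"
    then have "(a - b * s - c * s') *\<^sub>R \<one> + b *\<^sub>R x + c *\<^sub>R x' = 0"
      by (simp add: y_def z_def algebra_simps)
    then have "a - b * s - c * s' = 0 \<and> b = 0 \<and> c = 0" using ind unfolding ind3_def by blast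
    then show "a = 0 \<and> b = 0 \<and> c = 0" by auto
  qed
  show thesis
  proof (cases "\<exists>y. y \<star> (y \<star> y) = 0 \<and> y \<star> y \<noteq> 0")
    case True
    then obtain w where w: "w \<star> (w \<star> w) = 0" "w \<star> w \<noteq> 0" by blast
    have w4: "(w \<star> w) \<star> (w \<star> w) = 0" by (simp add: assoc w mult_simps)
    have "ind3 \<one> w (w \<star> w)"
      unfolding ind3_def
    proof (intro allI impI)
      fix a b c assume eq: "a *\<^sub>R \<one> + b *\<^sub>R w + c *\<^sub>R (w \<star> w) = 0"
      have "(w \<star> w) \<star> (a *\<^sub>R \<one> + b *\<^sub>R w + c *\<^sub>R (w \<star> w)) = 0"
        unfolding eq by (simp add: mult_simps)
      then have "a = 0" using w by (simp add: mult_simps w4 commute[of "w \<star> w" w])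
      have "w \<star> (a *\<^sub>R \<one> + b *\<^sub>R w + c *\<^sub>R (w \<star> w)) = 0"
        unfolding eq by (simp add: mult_simps)
      then have "b = 0" using w \<open>a = 0\<close> by (simp add: mult_simps)
      then show "a = 0 \<and> b = 0 \<and> c = 0" using eq \<open>a = 0\<close> w by simp
    qed
    then show thesis using that(2)[of w "w \<star> w"] w w4 by simp
  next
    case False
    then have yy: "y \<star> y = 0" and zz: "z \<star> z = 0" using y z by blast+
    have "z \<star> (z \<star> y) = 0" using zz by (simp add: mult_simps flip: assoc)
    moreover have "y \<star> (z \<star> y) = 0" using yy by (simp add: left_commute[of y z] mult_simps)
    ultimately have "(y + z) \<star> ((y + z) \<star> (y + z)) = 0"
      by (simp add: mult_simps yy zz commute[of y z])
    \<comment> \<open>The sum has cube zero, hence square zero in the present case; polarization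
      leaves 2 (y \<star> z) = 0.\<close>
    then have "(y + z) \<star> (y + z) = 0" using False by blast
    then have "2 *\<^sub>R (y \<star> z) = 0"
      by (simp add: mult_simps yy zz commute[of z y] scaleR_2)
    then show thesis using that(3) ind yy zz by simp
  qed
qed

end

section \<open>Matrix models\<close>

text \<open>The semidirect product of the algebra m with its dual, the dual being identified with
  R^n by the inner product.\<close>

definition dual_model :: "(real^'n \<Rightarrow> real^'n \<Rightarrow> real^'n) \<Rightarrow> ((real^'n) \<times> (real^'n)) lie" where
  "dual_model m = \<lparr>lcarrier = UNIV,
     lbracket = (\<lambda>(x, d) (x', d'). (0, adjoint (m x) d' - adjoint (m x') d))\<rparr>"

definition matrix_model :: "(real^'n \<Rightarrow> real^'n^'n) \<Rightarrow> ((real^'n) \<times> (real^'n)) lie" where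
  "matrix_model A = \<lparr>lcarrier = UNIV,
     lbracket = (\<lambda>(x, d) (x', d'). (0, A x *v d' - A x' *v d))\<rparr>"

text \<open>
  The matrices \<open>A x\<close> describe the dual of the regular representation of the algebra \<open>m\<close>, in
  the basis given by \<open>T\<close>.
\<close>

lemma dual_model_iso:
  fixes m :: "real^'n \<Rightarrow> real^'n \<Rightarrow> real^'n"
  assumes bil: "bilinear m" and T: "linear T" "bij (T :: real^'n \<Rightarrow> real^'n)"
    and hom: "\<And>x y. T (m' x y) = m (T x) (T y)"
    and act: "\<And>x y d. (A x *v d) \<bullet> y = d \<bullet> m' x y"
  shows "dual_model m \<cong>\<^sub>L matrix_model A"
proof (rule lie_iso_linearI)
  \<comment> \<open>Functionals transform contragrediently to elements, so that the pairing is
    preserved: \<open>adjoint T d \<bullet> inv T x = d \<bullet> x\<close>.\<close>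
  let ?f = "\<lambda>(x, d). (inv T x, adjoint T d)"
  have T_inv: "T (inv T x) = x" "inv T (T x) = x" for x
    using T(2) by (simp_all add: bij_is_surj bij_is_inj surj_f_inv_f)
  have invT: "linear (inv T)"
    by (rule linearI) (metis T_inv linear_add[OF T(1)], metis T_inv linear_scale[OF T(1)])
  have S: "linear (adjoint T)" by (rule adjoint_linear[OF T(1)])
  have S_inner: "adjoint T d \<bullet> y = d \<bullet> T y" for d y
    by (metis adjoint_works[OF T(1)] inner_commute)
  show lin: "linear ?f"
    by (rule linearI) (auto simp: linear_add[OF invT] linear_add[OF S] linear_scale[OF invT]
      linear_scale[OF S])
  have "p = 0" if "?f p = 0" for p
  proof (cases p)
    case (Pair x d)
    have "x = 0" using that Pair T by (simp add: zero_prod_def)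
      (metis bij_is_surj linear_0 surj_f_inv_f)
    moreover have "d \<bullet> z = 0" for z
      using that Pair S_inner[of d "inv T z"] T(2)
      by (simp add: zero_prod_def bij_is_surj surj_f_inv_f)
    ultimately show ?thesis using Pair by (metis inner_eq_zero_iff zero_prod_def)
  qed
  then have inj: "inj ?f" using linear_injective_0[OF lin] by blast
  then show "inj_on ?f (lcarrier (dual_model m))" by (rule inj_on_subset) simp
  show "?f ` lcarrier (dual_model m) = lcarrier (matrix_model A)"
    using linear_injective_imp_surjective[OF lin inj] by (simp add: dual_model_def matrix_model_def)
  have key: "adjoint T (adjoint (m x) d) = A (inv T x) *v adjoint T d" for x d
  proof -
    have "linear (m x)" using bil by (simp add: bilinear_def)
    then have "adjoint T (adjoint (m x) d) \<bullet> y = (A (inv T x) *v adjoint T d) \<bullet> y" for y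
      using T(2) by (simp add: S_inner act hom bij_is_surj surj_f_inv_f)
        (metis adjoint_works inner_commute)
    then show ?thesis by (metis vector_eq_rdot)
  qed
  show "?f (lbracket (dual_model m) p q) = lbracket (matrix_model A) (?f p) (?f q)" for p q
    by (cases p; cases q)
      (simp add: dual_model_def matrix_model_def linear_diff[OF S] linear_0[OF invT] key)
qed

lemma matrix_model_iso:
  assumes "linear f" and "\<And>x d. f (x, d) = 0 \<Longrightarrow> x = 0 \<and> d = 0" and "range f = lcarrier M"
    and "\<And>x d x' d'. f (0, A x *v d' - A x' *v d) = lbracket M (f (x, d)) (f (x', d'))"
  shows "matrix_model A \<cong>\<^sub>L M"
proof (rule lie_iso_linearI[OF assms(1)])
  have "inj f" using assms(2) by (simp add: linear_injective_0[OF assms(1)] zero_prod_def)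
  then show "inj_on f (lcarrier (matrix_model A))" by (rule inj_on_subset) simp
qed (use assms(3,4) in \<open>auto simp: matrix_model_def\<close>)

text \<open>For targets whose carrier is the whole type, surjectivity is a count of
  dimensions.\<close>

lemma matrix_model_UNIV_iso:
  fixes f :: "(real^'n) \<times> (real^'n) \<Rightarrow> 'b::euclidean_space"
  assumes "linear f" and "\<And>x d. f (x, d) = 0 \<Longrightarrow> x = 0 \<and> d = 0"
    and "DIM('b) = 2 * CARD('n)" and "lcarrier M = UNIV"
    and "\<And>x d x' d'. f (0, A x *v d' - A x' *v d) = lbracket M (f (x, d)) (f (x', d'))"
  shows "matrix_model A \<cong>\<^sub>L M"
proof (rule matrix_model_iso[OF assms(1,2) _ assms(5)])
  have "inj f" using assms(2) by (simp add: linear_injective_0[OF assms(1)] zero_prod_def)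
  then show "range f = lcarrier M"
    using linear_injective_imp_surjective[OF assms(1)] assms(3,4) by simp
qed

lemma matrix_model_semidirect:
  assumes "linear A" and "inj A"
  shows "matrix_model A \<cong>\<^sub>L semidirect (range A)"
proof (rule matrix_model_iso)
  show "linear (\<lambda>(x, d). (A x, d))"
    by (rule linearI) (auto simp: linear_add[OF assms(1)] linear_scale[OF assms(1)])
  show "x = 0 \<and> d = 0" if "(case (x, d) of (x, d) \<Rightarrow> (A x, d)) = 0" for x and d :: "real^'a"
    using that assms linear_injective_0[OF assms(1)] by (simp add: zero_prod_def)
  show "range (\<lambda>(x, d). (A x, d)) = lcarrier (semidirect (range A))"
    by (auto simp: semidirect_def)
qed (simp add: semidirect_def linear_0[OF assms(1)])

definition mat2 :: "real \<Rightarrow> real \<Rightarrow> real \<Rightarrow> real \<Rightarrow> real^2^2" where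
  "mat2 a b c d = vector [vector [a, b], vector [c, d]]"

definition mat3 :: "real \<Rightarrow> real \<Rightarrow> real \<Rightarrow> real \<Rightarrow> real \<Rightarrow> real \<Rightarrow> real \<Rightarrow> real \<Rightarrow> real \<Rightarrow> real^3^3" where
  "mat3 a b c d e f g h i = vector [vector [a, b, c], vector [d, e, f], vector [g, h, i]]"

lemma mat2_nth [simp]:
  "mat2 a b c d $ 1 = vector [a, b]" "mat2 a b c d $ 2 = vector [c, d]"
  by (simp_all add: mat2_def)

lemma mat3_nth [simp]:
  "mat3 a b c d e f g h i $ 1 = vector [a, b, c]"
  "mat3 a b c d e f g h i $ 2 = vector [d, e, f]"
  "mat3 a b c d e f g h i $ 3 = vector [g, h, i]"
  by (simp_all add: mat3_def)

lemma vector_4 [simp]: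
  "(vector [a, b, c, d] :: real^4) $ 1 = a" "(vector [a, b, c, d] :: real^4) $ 2 = b"
  "(vector [a, b, c, d] :: real^4) $ 3 = c" "(vector [a, b, c, d] :: real^4) $ 4 = d"
  by (simp_all add: vector_def)

lemmas vec2 = vec_eq_iff forall_2 matrix_vector_mult_def matrix_matrix_mult_def sum_2 mat_def
  inner_vec_def E_def axis_def
lemmas vec3 = vec_eq_iff forall_3 matrix_vector_mult_def matrix_matrix_mult_def sum_3 mat_def
  inner_vec_def E_def axis_def

section \<open>Polynomials in a matrix and nonderogatory matrices\<close>

lemma poly_mat_eq:
  assumes "degree p \<le> n"
  shows "poly_mat p A = (\<Sum>i\<le>n. coeff p i *\<^sub>R mat_pow A i)"
  unfolding poly_mat_def
  by (rule sum.mono_neutral_left) (use assms in \<open>auto simp: coeff_eq_0\<close>)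

lemma mat_pow_simps: "mat_pow A 0 = mat 1" "mat_pow A (Suc k) = A ** mat_pow A k"
  by (simp_all add: mat_pow_def)

lemma poly_mat_in_subspace:
  assumes "subspace W" and "mat 1 \<in> W" and "\<And>w. w \<in> W \<Longrightarrow> A ** w \<in> W"
  shows "poly_mat p A \<in> W"
proof -
  have "mat_pow A k \<in> W" for k
    by (induction k) (simp_all add: mat_pow_simps assms)
  then show ?thesis
    unfolding poly_mat_def by (intro subspace_sum subspace_scale assms(1))
qed

lemma cayley_hamilton_2:
  fixes A :: "real^2^2"
  shows "A ** A = (A $ 1 $ 1 + A $ 2 $ 2) *\<^sub>R A - det A *\<^sub>R mat 1"
  by (simp add: vec2 det_2 algebra_simps)

lemma cayley_hamilton_3:
  fixes A :: "real^3^3"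
  shows "A ** (A ** A) = (A $ 1 $ 1 + A $ 2 $ 2 + A $ 3 $ 3) *\<^sub>R (A ** A)
    - (A $ 1 $ 1 * A $ 2 $ 2 + A $ 1 $ 1 * A $ 3 $ 3 + A $ 2 $ 2 * A $ 3 $ 3
        - A $ 1 $ 2 * A $ 2 $ 1 - A $ 1 $ 3 * A $ 3 $ 1 - A $ 2 $ 3 * A $ 3 $ 2) *\<^sub>R A
    + det A *\<^sub>R mat 1"
  by (simp add: vec3 det_3 algebra_simps)

lemma matrix_mult_add_scale:
  fixes A B C :: "real^'n^'n"
  shows "A ** (B + C) = A ** B + A ** C" "A ** (r *\<^sub>R B) = r *\<^sub>R (A ** B)"
    "A ** (B - C) = A ** B - A ** C"
  by (simp_all add: matrix_add_ldistrib matrix_scalar_ac scalar_matrix_assoc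
    matrix_matrix_mult_def vec_eq_iff algebra_simps sum.distrib sum_distrib_left sum_subtractf)

text \<open>Cayley-Hamilton makes the span of 1 and A stable under multiplication by A, so it
  contains all powers.\<close>

lemma matrix_polys_2:
  fixes A :: "real^2^2"
  shows "matrix_polys A = {a *\<^sub>R mat 1 + b *\<^sub>R A | a b. True}" (is "_ = ?W")
proof
  have W: "a *\<^sub>R mat 1 + b *\<^sub>R A \<in> ?W" for a b by blast
  have "subspace ?W"
  proof (rule subspaceI)
    show "0 \<in> ?W" using W[of 0 0] by simp
    show "x + y \<in> ?W" if xy: "x \<in> ?W" "y \<in> ?W" for x y
    proof -
      obtain a b c d where "x = a *\<^sub>R mat 1 + b *\<^sub>R A" "y = c *\<^sub>R mat 1 + d *\<^sub>R A"
        using xy by blast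
      then have "x + y = (a + c) *\<^sub>R mat 1 + (b + d) *\<^sub>R A" by (simp add: algebra_simps)
      then show ?thesis by (simp only: W)
    qed
    show "r *\<^sub>R x \<in> ?W" if x: "x \<in> ?W" for x r
    proof -
      obtain a b where "x = a *\<^sub>R mat 1 + b *\<^sub>R A" using x by blast
      then have "r *\<^sub>R x = (r * a) *\<^sub>R mat 1 + (r * b) *\<^sub>R A" by (simp add: algebra_simps)
      then show ?thesis by (simp only: W)
    qed
  qed
  moreover have "mat 1 \<in> ?W" using W[of 1 0] by simp
  moreover have "A ** w \<in> ?W" if w: "w \<in> ?W" for w
  proof -
    obtain a b where "w = a *\<^sub>R mat 1 + b *\<^sub>R A" using w by blast
    then have "A ** w = (- b * det A) *\<^sub>R mat 1 + (a + b * (A $ 1 $ 1 + A $ 2 $ 2)) *\<^sub>R A"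
      by (simp add: matrix_mult_add_scale cayley_hamilton_2 algebra_simps)
    then show ?thesis by (simp only: W)
  qed
  ultimately show "matrix_polys A \<subseteq> ?W"
    unfolding matrix_polys_def using poly_mat_in_subspace by blast
  have "a *\<^sub>R mat 1 + b *\<^sub>R A = poly_mat [:a, b:] A" for a b
    by (subst poly_mat_eq[where n = 1]) (simp_all add: mat_pow_simps)
  then show "?W \<subseteq> matrix_polys A" unfolding matrix_polys_def by auto
qed

lemma matrix_polys_3:
  fixes A :: "real^3^3"
  shows "matrix_polys A = {a *\<^sub>R mat 1 + b *\<^sub>R A + c *\<^sub>R (A ** A) | a b c. True}" (is "_ = ?W")
proof
  have W: "a *\<^sub>R mat 1 + b *\<^sub>R A + c *\<^sub>R (A ** A) \<in> ?W" for a b c by blast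
  have "subspace ?W"
  proof (rule subspaceI)
    show "0 \<in> ?W" using W[of 0 0 0] by simp
    show "x + y \<in> ?W" if xy: "x \<in> ?W" "y \<in> ?W" for x y
    proof -
      obtain a b c a' b' c' where "x = a *\<^sub>R mat 1 + b *\<^sub>R A + c *\<^sub>R (A ** A)"
        "y = a' *\<^sub>R mat 1 + b' *\<^sub>R A + c' *\<^sub>R (A ** A)"
        using xy by blast
      then have "x + y = (a + a') *\<^sub>R mat 1 + (b + b') *\<^sub>R A + (c + c') *\<^sub>R (A ** A)"
        by (simp add: algebra_simps)
      then show ?thesis by (simp only: W)
    qed
    show "r *\<^sub>R x \<in> ?W" if x: "x \<in> ?W" for x r
    proof -
      obtain a b c where "x = a *\<^sub>R mat 1 + b *\<^sub>R A + c *\<^sub>R (A ** A)" using x by blast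
      then have "r *\<^sub>R x = (r * a) *\<^sub>R mat 1 + (r * b) *\<^sub>R A + (r * c) *\<^sub>R (A ** A)"
        by (simp add: algebra_simps)
      then show ?thesis by (simp only: W)
    qed
  qed
  moreover have "mat 1 \<in> ?W" using W[of 1 0 0] by simp
  moreover have "A ** w \<in> ?W" if w: "w \<in> ?W" for w
  proof -
    obtain a b c where w: "w = a *\<^sub>R mat 1 + b *\<^sub>R A + c *\<^sub>R (A ** A)" using w by blast
    obtain t s where ch: "A ** (A ** A) = t *\<^sub>R (A ** A) - s *\<^sub>R A + det A *\<^sub>R mat 1"
      using cayley_hamilton_3 by blast
    have "A ** w = (c * det A) *\<^sub>R mat 1 + (a - c * s) *\<^sub>R A + (b + c * t) *\<^sub>R (A ** A)"
      by (simp add: w matrix_mult_add_scale ch algebra_simps)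
    then show ?thesis by (simp only: W)
  qed
  ultimately show "matrix_polys A \<subseteq> ?W"
    unfolding matrix_polys_def using poly_mat_in_subspace by blast
  have "a *\<^sub>R mat 1 + b *\<^sub>R A + c *\<^sub>R (A ** A) = poly_mat [:a, b, c:] A" for a b c
    by (subst poly_mat_eq[where n = 2]) (simp_all add: mat_pow_simps numeral_2_eq_2)
  then show "?W \<subseteq> matrix_polys A" unfolding matrix_polys_def by auto
qed

text \<open>The characteristic polynomial annihilates A by Cayley-Hamilton; independence of 1 and A
  rules out annihilating polynomials of smaller degree.\<close>

lemma nonderogatory_2:
  fixes A :: "real^2^2"
  assumes "\<And>a b. a *\<^sub>R mat 1 + b *\<^sub>R A = 0 \<Longrightarrow> a = 0 \<and> b = 0"
  shows "nonderogatory A"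
proof -
  have char: "char_poly A = [:det A, - (A $ 1 $ 1 + A $ 2 $ 2), 1:]"
    by (simp add: char_poly_def det_2 mat_def algebra_simps)
  have "poly_mat (char_poly A) A = 0"
    by (subst poly_mat_eq[where n = 2])
      (simp_all add: char mat_pow_simps numeral_2_eq_2 cayley_hamilton_2 algebra_simps)
  moreover have "degree (char_poly A) \<le> degree q" if q: "q \<noteq> 0" "poly_mat q A = 0" for q
  proof (rule ccontr)
    assume "\<not> degree (char_poly A) \<le> degree q"
    then have deg: "degree q \<le> 1" by (simp add: char)
    then have "coeff q 0 *\<^sub>R mat 1 + coeff q 1 *\<^sub>R A = 0"
      using q(2) by (simp add: poly_mat_eq[OF deg] mat_pow_simps)
    then have "coeff q 0 = 0" "coeff q 1 = 0" using assms by blast+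
    then have "lead_coeff q = 0" using deg by (cases "degree q") auto
    then show False using q(1) by simp
  qed
  ultimately show ?thesis by (simp add: nonderogatory_def is_min_poly_def char)
qed

lemma nonderogatory_3:
  fixes A :: "real^3^3"
  assumes "\<And>a b c. a *\<^sub>R mat 1 + b *\<^sub>R A + c *\<^sub>R (A ** A) = 0 \<Longrightarrow> a = 0 \<and> b = 0 \<and> c = 0"
  shows "nonderogatory A"
proof -
  have char: "char_poly A = [:- det A,
      A $ 1 $ 1 * A $ 2 $ 2 + A $ 1 $ 1 * A $ 3 $ 3 + A $ 2 $ 2 * A $ 3 $ 3
        - A $ 1 $ 2 * A $ 2 $ 1 - A $ 1 $ 3 * A $ 3 $ 1 - A $ 2 $ 3 * A $ 3 $ 2,
      - (A $ 1 $ 1 + A $ 2 $ 2 + A $ 3 $ 3), 1:]"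
    by (simp add: char_poly_def det_3 mat_def algebra_simps)
  have "poly_mat (char_poly A) A = 0"
    by (subst poly_mat_eq[where n = 3])
      (simp_all add: char mat_pow_simps numeral_3_eq_3 cayley_hamilton_3 algebra_simps)
  moreover have "degree (char_poly A) \<le> degree q" if q: "q \<noteq> 0" "poly_mat q A = 0" for q
  proof (rule ccontr)
    assume "\<not> degree (char_poly A) \<le> degree q"
    then have deg: "degree q \<le> 2" by (simp add: char)
    then have "coeff q 0 *\<^sub>R mat 1 + coeff q 1 *\<^sub>R A + coeff q 2 *\<^sub>R (A ** A) = 0"
      using q(2) by (simp add: poly_mat_eq[OF deg] mat_pow_simps numeral_2_eq_2)
    then have "coeff q 0 = 0" "coeff q 1 = 0" "coeff q 2 = 0" using assms by blast+
    moreover have "degree q = 0 \<or> degree q = 1 \<or> degree q = 2" using deg by linarith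
    ultimately have "lead_coeff q = 0" by metis
    then show False using q(1) by simp
  qed
  ultimately show ?thesis by (simp add: nonderogatory_def is_min_poly_def char)
qed

text \<open>For n = 1 all matrices are scalar, so 0 serves as \<psi>; its characteristic polynomial
  is t, and no nonzero constant annihilates it.\<close>

lemma nonderogatory_1: "nonderogatory (0 :: real^1^1)"
proof -
  have char: "char_poly (0 :: real^1^1) = [:0, 1:]"
    by (simp add: char_poly_def det_diagonal mat_def)
  have "poly_mat (char_poly (0 :: real^1^1)) (0 :: real^1^1) = 0"
    by (subst poly_mat_eq[where n = 1])
      (simp_all add: char mat_pow_simps matrix_matrix_mult_def vec_eq_iff)
  moreover have "degree (char_poly (0 :: real^1^1)) \<le> degree q"
    if q: "q \<noteq> 0" "poly_mat q (0 :: real^1^1) = 0" for q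
  proof (rule ccontr)
    assume "\<not> degree (char_poly (0 :: real^1^1)) \<le> degree q"
    then have deg: "degree q \<le> 0" by (simp add: char)
    have "coeff q 0 = 0"
      using q(2) by (simp add: poly_mat_eq[OF deg] mat_pow_simps vec_eq_iff mat_def)
    then show False using q(1) deg by (metis le_zero_eq leading_coeff_0_iff)
  qed
  ultimately show ?thesis by (simp add: nonderogatory_def is_min_poly_def char)
qed

lemma matrix_polys_1: "matrix_polys (0 :: real^1^1) = {a *\<^sub>R mat 1 | a. True}" (is "_ = ?W")
proof
  have all: "w = (w $ 1 $ 1) *\<^sub>R mat 1" for w :: "real^1^1"
    by (simp add: vec_eq_iff mat_def)
  then show "matrix_polys (0 :: real^1^1) \<subseteq> ?W" by blast
  have "a *\<^sub>R (mat 1 :: real^1^1) = poly_mat [:a:] 0" for a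
    by (subst poly_mat_eq[where n = 0]) (simp_all add: mat_pow_simps)
  then show "?W \<subseteq> matrix_polys (0 :: real^1^1)" unfolding matrix_polys_def by auto
qed

section \<open>The normal forms\<close>

lemma matrix_model_G_psi:
  assumes "linear A" and "inj A" and "range A = matrix_polys \<psi>"
  shows "matrix_model A \<cong>\<^sub>L G_psi \<psi>"
  using matrix_model_semidirect[OF assms(1,2)] by (simp add: assms(3) G_psi_def)

lemma linear_injI: "linear f \<Longrightarrow> (\<And>x. f x = 0 \<Longrightarrow> x = 0) \<Longrightarrow> inj f"
  by (simp add: linear_injective_0)

text \<open>
  The subscripts name the algebra: \<open>R\<close> and \<open>C\<close> are the fields, \<open>E\<close> is \<open>\<real>[t]/(t\<^sup>2)\<close>, \<open>N\<close> is
  \<open>\<real>[t]/(t\<^sup>3)\<close>, and \<open>31\<close> is \<open>\<real>[s, t]/(s, t)\<^sup>2\<close>; juxtaposition is the product of algebras.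
\<close>

definition A_1 :: "real^1 \<Rightarrow> real^1^1" where
  "A_1 x = x $ 1 *\<^sub>R mat 1"

definition A_RR :: "real^2 \<Rightarrow> real^2^2" where
  "A_RR x = mat2 (x $ 1) 0 0 (x $ 2)"

definition A_E :: "real^2 \<Rightarrow> real^2^2" where
  "A_E x = mat2 (x $ 1) (x $ 2) 0 (x $ 1)"

definition A_C :: "real^2 \<Rightarrow> real^2^2" where
  "A_C x = mat2 (x $ 1) (x $ 2) (- x $ 2) (x $ 1)"

definition A_RRR :: "real^3 \<Rightarrow> real^3^3" where
  "A_RRR x = mat3 (x $ 1) 0 0  0 (x $ 2) 0  0 0 (x $ 3)"

definition A_ER :: "real^3 \<Rightarrow> real^3^3" where
  "A_ER x = mat3 (x $ 1) (x $ 2) 0  0 (x $ 1) 0  0 0 (x $ 3)"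

definition A_CR :: "real^3 \<Rightarrow> real^3^3" where
  "A_CR x = mat3 (x $ 1) (x $ 2) 0  (- x $ 2) (x $ 1) 0  0 0 (x $ 3)"

definition A_N :: "real^3 \<Rightarrow> real^3^3" where
  "A_N x = mat3 (x $ 1) (x $ 2) (x $ 3)  0 (x $ 1) (x $ 2)  0 0 (x $ 1)"

definition A_31 :: "real^3 \<Rightarrow> real^3^3" where
  "A_31 x = mat3 (x $ 1) (x $ 2) (x $ 3)  0 (x $ 1) 0  0 0 (x $ 1)"

lemmas A_defs = A_1_def A_RR_def A_E_def A_C_def A_RRR_def A_ER_def A_CR_def A_N_def A_31_def

lemma linear_A:
  "linear A_1" "linear A_RR" "linear A_E" "linear A_C"
  "linear A_RRR" "linear A_ER" "linear A_CR" "linear A_N" "linear A_31"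
  by (rule linearI; simp add: A_defs vec2 vec3 algebra_simps)+

lemma inj_A:
  "inj A_1" "inj A_RR" "inj A_E" "inj A_C" "inj A_RRR" "inj A_ER" "inj A_CR" "inj A_N" "inj A_31"
  by (rule linear_injI[OF linear_A(1)] linear_injI[OF linear_A(2)] linear_injI[OF linear_A(3)]
    linear_injI[OF linear_A(4)] linear_injI[OF linear_A(5)] linear_injI[OF linear_A(6)]
    linear_injI[OF linear_A(7)] linear_injI[OF linear_A(8)] linear_injI[OF linear_A(9)],
    simp add: A_defs vec2 vec3)+

lemma G_psi_1: "nonderogatory (0 :: real^1^1)" "matrix_model A_1 \<cong>\<^sub>L G_psi (0 :: real^1^1)"
proof -
  have "a *\<^sub>R mat 1 \<in> range A_1" for a
    by (rule range_eqI[of _ _ "vec a"]) (simp add: A_1_def)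
  then have "range A_1 = matrix_polys 0" by (auto simp: matrix_polys_1 A_1_def)
  then show "matrix_model A_1 \<cong>\<^sub>L G_psi (0 :: real^1^1)"
    by (intro matrix_model_G_psi linear_A inj_A)
qed (rule nonderogatory_1)

text \<open>The functions a and b read off the coefficients of \<open>A x\<close> at 1 and \<psi>,
  and X is a section of them, which shows that every polynomial in \<psi> occurs.\<close>

lemma G_psi_2I:
  assumes "linear A" "inj A"
    and "\<And>x. A x = a x *\<^sub>R mat 1 + b x *\<^sub>R (\<psi> :: real^2^2)"
    and "\<And>r s. a (X r s) = r" "\<And>r s. b (X r s) = s"
  shows "matrix_model A \<cong>\<^sub>L G_psi \<psi>"
proof -
  have "r *\<^sub>R mat 1 + s *\<^sub>R \<psi> \<in> range A" for r s
    by (rule range_eqI[of _ _ "X r s"]) (simp add: assms(3-5))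
  then have "range A = matrix_polys \<psi>" unfolding matrix_polys_2 using assms(3) by blast
  then show ?thesis by (intro matrix_model_G_psi assms)
qed

lemma G_psi_3I:
  assumes "linear A" "inj A"
    and "\<And>x. A x = a x *\<^sub>R mat 1 + b x *\<^sub>R (\<psi> :: real^3^3) + c x *\<^sub>R (\<psi> ** \<psi>)"
    and "\<And>r s t. a (X r s t) = r" "\<And>r s t. b (X r s t) = s" "\<And>r s t. c (X r s t) = t"
  shows "matrix_model A \<cong>\<^sub>L G_psi \<psi>"
proof -
  have "r *\<^sub>R mat 1 + s *\<^sub>R \<psi> + t *\<^sub>R (\<psi> ** \<psi>) \<in> range A" for r s t
    by (rule range_eqI[of _ _ "X r s t"]) (simp add: assms(3-6))
  then have "range A = matrix_polys \<psi>" unfolding matrix_polys_3 using assms(3) by blast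
  then show ?thesis by (intro matrix_model_G_psi assms)
qed

lemma G_psi_RR:
  "nonderogatory (mat2 0 0 0 1)" "matrix_model A_RR \<cong>\<^sub>L G_psi (mat2 0 0 0 1)"
proof -
  show "nonderogatory (mat2 0 0 0 1)"
    by (rule nonderogatory_2) (auto simp: vec2)
  show "matrix_model A_RR \<cong>\<^sub>L G_psi (mat2 0 0 0 1)"
    by (rule G_psi_2I[OF linear_A(2) inj_A(2), where a = "\<lambda>x. x $ 1" and b = "\<lambda>x. x $ 2 - x $ 1"
      and X = "\<lambda>r s. vector [r, r + s]"]) (simp_all add: A_RR_def vec2)
qed

lemma G_psi_E:
  "nonderogatory (E 1 2 :: real^2^2)" "matrix_model A_E \<cong>\<^sub>L G_psi (E 1 2 :: real^2^2)"
proof -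
  show "nonderogatory (E 1 2 :: real^2^2)"
    by (rule nonderogatory_2) (auto simp: vec2)
  show "matrix_model A_E \<cong>\<^sub>L G_psi (E 1 2 :: real^2^2)"
    by (rule G_psi_2I[OF linear_A(3) inj_A(3), where a = "\<lambda>x. x $ 1" and b = "\<lambda>x. x $ 2"
      and X = "\<lambda>r s. vector [r, s]"]) (simp_all add: A_E_def vec2)
qed

lemma G_psi_C:
  "nonderogatory (mat2 0 1 (-1) 0)" "matrix_model A_C \<cong>\<^sub>L G_psi (mat2 0 1 (-1) 0)"
proof -
  show "nonderogatory (mat2 0 1 (-1) 0)"
    by (rule nonderogatory_2) (auto simp: vec2)
  show "matrix_model A_C \<cong>\<^sub>L G_psi (mat2 0 1 (-1) 0)"
    by (rule G_psi_2I[OF linear_A(4) inj_A(4), where a = "\<lambda>x. x $ 1" and b = "\<lambda>x. x $ 2"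
      and X = "\<lambda>r s. vector [r, s]"]) (simp_all add: A_C_def vec2)
qed

text \<open>Lagrange interpolation at the eigenvalues 0, 1, -1 of \<psi>: a, b, c are the
  coefficients of the quadratic polynomial with values x$1, x$2, x$3 there, and X evaluates such a
  polynomial.\<close>

lemma G_psi_RRR:
  "nonderogatory (mat3 0 0 0 0 1 0 0 0 (-1))"
  "matrix_model A_RRR \<cong>\<^sub>L G_psi (mat3 0 0 0 0 1 0 0 0 (-1))"
proof -
  show "nonderogatory (mat3 0 0 0 0 1 0 0 0 (-1))"
    by (rule nonderogatory_3) (auto simp: vec3)
  show "matrix_model A_RRR \<cong>\<^sub>L G_psi (mat3 0 0 0 0 1 0 0 0 (-1))"
    by (rule G_psi_3I[OF linear_A(5) inj_A(5), where a = "\<lambda>x. x $ 1"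
      and b = "\<lambda>x. (x $ 2 - x $ 3) / 2" and c = "\<lambda>x. (x $ 2 + x $ 3) / 2 - x $ 1"
      and X = "\<lambda>r s t. vector [r, r + s + t, r - s + t]"])
      (simp_all add: A_RRR_def vec3 field_simps)
qed

text \<open>Hermite interpolation: the polynomial has value x$1 and derivative x$2 at the double
  eigenvalue 0, and value x$3 at 1.\<close>

lemma G_psi_ER:
  "nonderogatory (mat3 0 1 0 0 0 0 0 0 1)" "matrix_model A_ER \<cong>\<^sub>L G_psi (mat3 0 1 0 0 0 0 0 0 1)"
proof -
  show "nonderogatory (mat3 0 1 0 0 0 0 0 0 1)"
    by (rule nonderogatory_3) (auto simp: vec3)
  show "matrix_model A_ER \<cong>\<^sub>L G_psi (mat3 0 1 0 0 0 0 0 0 1)"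
    by (rule G_psi_3I[OF linear_A(6) inj_A(6), where a = "\<lambda>x. x $ 1"
      and b = "\<lambda>x. x $ 2" and c = "\<lambda>x. x $ 3 - x $ 1 - x $ 2"
      and X = "\<lambda>r s t. vector [r, s, r + s + t]"])
      (simp_all add: A_ER_def vec3)
qed

text \<open>Interpolation at i, where the value is x$1 + i x$2, and at 0, where it is x$3.\<close>

lemma G_psi_CR:
  "nonderogatory (mat3 0 1 0 (-1) 0 0 0 0 0)"
  "matrix_model A_CR \<cong>\<^sub>L G_psi (mat3 0 1 0 (-1) 0 0 0 0 0)"
proof -
  show "nonderogatory (mat3 0 1 0 (-1) 0 0 0 0 0)"
    by (rule nonderogatory_3) (auto simp: vec3)
  show "matrix_model A_CR \<cong>\<^sub>L G_psi (mat3 0 1 0 (-1) 0 0 0 0 0)"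
    by (rule G_psi_3I[OF linear_A(7) inj_A(7), where a = "\<lambda>x. x $ 3"
      and b = "\<lambda>x. x $ 2" and c = "\<lambda>x. x $ 3 - x $ 1"
      and X = "\<lambda>r s t. vector [r - t, s, r]"])
      (simp_all add: A_CR_def vec3)
qed

lemma G_psi_N:
  "nonderogatory (E 1 2 + E 2 3 :: real^3^3)" "matrix_model A_N \<cong>\<^sub>L G_psi (E 1 2 + E 2 3 :: real^3^3)"
proof -
  show "nonderogatory (E 1 2 + E 2 3 :: real^3^3)"
    by (rule nonderogatory_3) (auto simp: vec3)
  show "matrix_model A_N \<cong>\<^sub>L G_psi (E 1 2 + E 2 3 :: real^3^3)"
    by (rule G_psi_3I[OF linear_A(8) inj_A(8), where a = "\<lambda>x. x $ 1"
      and b = "\<lambda>x. x $ 2" and c = "\<lambda>x. x $ 3" and X = "\<lambda>r s t. vector [r, s, t]"])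
      (simp_all add: A_N_def vec3)
qed

lemma matrix_model_31: "matrix_model A_31 \<cong>\<^sub>L G_3_1"
proof -
  have A: "A_31 x = x $ 1 *\<^sub>R mat 1 + x $ 2 *\<^sub>R E 1 2 + x $ 3 *\<^sub>R E 1 3" for x
    by (simp add: A_31_def vec3)
  have "A_31 x \<in> B_3_1" for x
    unfolding A B_3_1_def by (intro span_add span_scale span_base) auto
  moreover have "w \<in> range A_31" if w: "w \<in> B_3_1" for w
  proof -
    obtain r s t where "w - r *\<^sub>R mat 1 - s *\<^sub>R E 1 2 - t *\<^sub>R E 1 3 = 0"
      using w by (auto simp: B_3_1_def span_breakdown_eq)
    then have "w = A_31 (vector [r, s, t])" by (simp add: A algebra_simps)
    then show ?thesis by blast
  qed
  ultimately have "range A_31 = B_3_1" by blast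
  then show ?thesis using matrix_model_semidirect[OF linear_A(9) inj_A(9)] by (simp add: G_3_1_def)
qed

section \<open>Identification with the named Lie algebras\<close>

lemma matrix_model_aff_R: "matrix_model A_1 \<cong>\<^sub>L aff_R"
proof (rule matrix_model_UNIV_iso)
  show "linear (\<lambda>(x :: real^1, d :: real^1). vector [x $ 1, d $ 1] :: real^2)"
    by (rule linearI) (auto simp: vec2)
qed (auto simp: A_1_def aff_R_def wedge_def vec2)

lemma matrix_model_RR: "matrix_model A_RR \<cong>\<^sub>L aff_R \<oplus>\<^sub>L aff_R"
proof (rule matrix_model_UNIV_iso)
  show "linear (\<lambda>(x :: real^2, d :: real^2).
      (vector [x $ 1, d $ 1] :: real^2, vector [x $ 2, d $ 2] :: real^2))"
    by (rule linearI) (auto simp: vec2)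
qed (auto simp: A_RR_def aff_R_def lie_sum_def wedge_def vec2 zero_prod_def)

text \<open>In \<open>aff_C\<close> the vector \<open>e_2\<close> acts on the plane of
  \<open>e_3\<close> and \<open>e_4\<close> by \<open>mat2 0 (-1) 1 0\<close>, the negative of the
  matrix that x$2 multiplies in \<open>A_C\<close>; hence the sign at x$2.\<close>

lemma matrix_model_C: "matrix_model A_C \<cong>\<^sub>L aff_C"
proof (rule matrix_model_UNIV_iso)
  show "linear (\<lambda>(x :: real^2, d :: real^2). vector [x $ 1, - x $ 2, d $ 1, d $ 2] :: real^4)"
    by (rule linearI) (auto simp: vec_eq_iff forall_4)
qed (auto simp: A_C_def aff_C_def wedge_def vec2 forall_4)

lemma matrix_model_RRR: "matrix_model A_RRR \<cong>\<^sub>L aff_R \<oplus>\<^sub>L aff_R \<oplus>\<^sub>L aff_R"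
proof (rule matrix_model_UNIV_iso)
  show "linear (\<lambda>(x :: real^3, d :: real^3). ((vector [x $ 1, d $ 1] :: real^2,
      vector [x $ 2, d $ 2] :: real^2), vector [x $ 3, d $ 3] :: real^2))"
    by (rule linearI) (auto simp: vec2)
qed (auto simp: A_RRR_def aff_R_def lie_sum_def wedge_def vec3 zero_prod_def forall_2)

lemma matrix_model_CR: "matrix_model A_CR \<cong>\<^sub>L aff_C \<oplus>\<^sub>L aff_R"
proof (rule matrix_model_UNIV_iso)
  show "linear (\<lambda>(x :: real^3, d :: real^3). (vector [x $ 1, - x $ 2, d $ 1, d $ 2] :: real^4,
      vector [x $ 3, d $ 3] :: real^2))"
    by (rule linearI) (auto simp: vec2 forall_4)
qed (auto simp: A_CR_def aff_R_def aff_C_def lie_sum_def wedge_def vec3 zero_prod_def forall_2 forall_4)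

lemma matrix_model_E: "matrix_model A_E \<cong>\<^sub>L (D_0 :: ((real^2^2) \<times> (real^2)) lie)"
  using G_psi_E by (simp add: D_0_def M_0_2)

lemma matrix_model_N: "matrix_model A_N \<cong>\<^sub>L (D_0 :: ((real^3^3) \<times> (real^3)) lie)"
  using G_psi_N by (simp add: D_0_def M_0_3)

text \<open>The carrier of \<open>D_0\<close> is a proper subspace of its ambient type, so the range
  of the map is computed explicitly, with \<open>matrix_polys_2\<close>.\<close>

lemma matrix_model_ER:
  "matrix_model A_ER \<cong>\<^sub>L (D_0 :: ((real^2^2) \<times> (real^2)) lie) \<oplus>\<^sub>L aff_R"
proof (rule matrix_model_iso)
  let ?f = "\<lambda>(x :: real^3, d :: real^3). ((x $ 1 *\<^sub>R mat 1 + x $ 2 *\<^sub>R E 1 2 :: real^2^2,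
      vector [d $ 1, d $ 2] :: real^2), vector [x $ 3, d $ 3] :: real^2)"
  show "linear ?f" by (rule linearI) (auto simp: vec2 algebra_simps)
  have carrier: "lcarrier (D_0 :: ((real^2^2) \<times> (real^2)) lie) =
      {a *\<^sub>R mat 1 + b *\<^sub>R E 1 2 | a b. True} \<times> UNIV"
    by (simp add: D_0_def M_0_2 G_psi_def semidirect_def matrix_polys_2)
  have "((a *\<^sub>R mat 1 + b *\<^sub>R E 1 2, v), w) \<in> range ?f" for a b v w
    by (rule range_eqI[of _ _ "(vector [a, b, w $ 1], vector [v $ 1, v $ 2, w $ 2])"])
      (simp add: vec2)
  then show "range ?f = lcarrier ((D_0 :: ((real^2^2) \<times> (real^2)) lie) \<oplus>\<^sub>L aff_R)"
    by (auto simp: carrier lie_sum_def aff_R_def)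
  show "x = 0 \<and> d = 0" if "?f (x, d) = 0" for x d
    using that by (auto simp: vec3 forall_2 zero_prod_def)
qed (auto simp: A_ER_def D_0_def G_psi_def semidirect_def aff_R_def lie_sum_def wedge_def vec3
  forall_2 sum_2 algebra_simps)

section \<open>Change of the index type\<close>

text \<open>Relabels the basis along a bijection, to carry a normal form from a numeral type to the
  index type \<open>'n\<close> of the theorem, of which only the cardinality is known.\<close>

definition reindex :: "('n \<Rightarrow> 'm) \<Rightarrow> 'a^'m^'m \<Rightarrow> 'a^'n^'n" where
  "reindex h A = (\<chi> i j. A $ h i $ h j)"

lemma reindex_nth [simp]: "reindex h A $ i $ j = A $ h i $ h j"
  by (simp add: reindex_def)

lemma linear_reindex: "linear (reindex h :: real^'m^'m \<Rightarrow> real^'n^'n)"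
  by (rule linearI) (simp_all add: vec_eq_iff)

lemma inj_reindex:
  assumes "bij h"
  shows "inj (reindex h)"
proof (rule injI)
  fix A B assume eq: "reindex h A = reindex h B"
  have "A $ i $ j = B $ i $ j" for i j
  proof -
    obtain k l where "i = h k" "j = h l" using assms by (metis bij_pointE)
    then show ?thesis using eq by (metis reindex_nth)
  qed
  then show "A = B" by (simp add: vec_eq_iff)
qed

lemma reindex_matrix_mult:
  fixes A B :: "real^'m^'m" and h :: "'n::finite \<Rightarrow> 'm::finite"
  assumes "bij h"
  shows "reindex h (A ** B) = reindex h A ** reindex h B"
proof -
  have "reindex h (A ** B) $ i $ j = (reindex h A ** reindex h B) $ i $ j" for i j
    using sum.reindex_bij_betw[OF assms, of "\<lambda>k. A $ h i $ k * B $ k $ h j"]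
    by (simp add: matrix_matrix_mult_def)
  then show ?thesis by (simp add: vec_eq_iff)
qed

lemma reindex_mult_vec:
  fixes A :: "real^'m^'m" and h :: "'n::finite \<Rightarrow> 'm::finite"
  assumes "bij h"
  shows "reindex h A *v (\<chi> i. x $ h i) = (\<chi> i. (A *v x) $ h i)"
proof -
  have "(reindex h A *v (\<chi> i. x $ h i)) $ i = (A *v x) $ h i" for i
    using sum.reindex_bij_betw[OF assms, of "\<lambda>k. A $ h i $ k * x $ k"]
    by (simp add: matrix_vector_mult_def)
  then show ?thesis by (simp add: vec_eq_iff)
qed

lemma reindex_mat: "bij h \<Longrightarrow> reindex h (mat k) = mat k"
  by (auto simp: vec_eq_iff mat_def bij_is_inj inj_eq)

text \<open>Conjugating a permutation by h preserves its sign, so the Leibniz sums agree term by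
  term. The entries are general because \<open>char_poly\<close> takes a determinant of
  polynomials.\<close>

lemma det_reindex:
  fixes A :: "'a::comm_ring_1^'m^'m" and h :: "'n::finite \<Rightarrow> 'm::finite"
  assumes h: "bij h"
  shows "det (reindex h A) = det A"
  unfolding det_def
proof (rule sum.reindex_bij_witness[where j = "map_permutation UNIV h"
      and i = "map_permutation UNIV (inv h)"])
  have bij_inv: "bij (inv h)" using h by (rule bij_imp_bij_inv)
  have inv: "inv h \<circ> h = id" "h \<circ> inv h = id"
    using h by (simp_all add: bij_is_inj bij_is_surj flip: surj_iff)
  fix p :: "'n \<Rightarrow> 'n" assume p: "p \<in> {p. p permutes UNIV}"
  show "map_permutation UNIV (inv h) (map_permutation UNIV h p) = p"
    using map_permutation_compose[OF h bij_is_inj[OF bij_inv], of p] p by (simp add: inv)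
  show "map_permutation UNIV h p \<in> {p. p permutes UNIV}"
    using map_permutation_permutes[OF h] p by blast
  have app: "map_permutation UNIV h p (h i) = h (p i)" for i
    using h by (simp add: map_permutation_def bij_is_inj bij_is_surj)
  have "(\<Prod>i\<in>UNIV. A $ i $ map_permutation UNIV h p i) = (\<Prod>i\<in>UNIV. A $ h i $ h (p i))"
    using prod.reindex_bij_betw[OF h, of "\<lambda>i. A $ i $ map_permutation UNIV h p i"] by (simp add: app)
  then show "of_int (sign (map_permutation UNIV h p)) * (\<Prod>i\<in>UNIV. A $ i $ map_permutation UNIV h p i)
      = of_int (sign p) * (\<Prod>i\<in>UNIV. reindex h A $ i $ p i)"
    using sign_map_permutation[OF bij_is_inj[OF h], of p] p by simp
next
  have bij_inv: "bij (inv h)" using h by (rule bij_imp_bij_inv)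
  have inv: "inv h \<circ> h = id" "h \<circ> inv h = id"
    using h by (simp_all add: bij_is_inj bij_is_surj flip: surj_iff)
  fix q :: "'m \<Rightarrow> 'm" assume q: "q \<in> {p. p permutes UNIV}"
  show "map_permutation UNIV h (map_permutation UNIV (inv h) q) = q"
    using map_permutation_compose[OF bij_inv bij_is_inj[OF h], of q] q by (simp add: inv)
  show "map_permutation UNIV (inv h) q \<in> {p. p permutes UNIV}"
    using map_permutation_permutes[OF bij_inv] q by blast
qed

lemma char_poly_reindex:
  fixes A :: "real^'m^'m" and h :: "'n::finite \<Rightarrow> 'm::finite"
  assumes h: "bij h"
  shows "char_poly (reindex h A) = char_poly A"
proof -
  have "mat [:0, 1:] - (\<chi> i j. [:reindex h A $ i $ j:])
      = reindex h (mat [:0, 1:] - (\<chi> i j. [:A $ i $ j:]))"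
    using h by (simp add: vec_eq_iff mat_def bij_is_inj inj_eq)
  then show ?thesis by (simp add: char_poly_def det_reindex[OF h])
qed

lemma poly_mat_reindex:
  fixes A :: "real^'m^'m" and h :: "'n::finite \<Rightarrow> 'm::finite"
  assumes h: "bij h"
  shows "poly_mat p (reindex h A) = reindex h (poly_mat p A)"
proof -
  have "mat_pow (reindex h A) k = reindex h (mat_pow A k)" for k
    by (induction k) (simp_all add: mat_pow_simps reindex_mat[OF h] reindex_matrix_mult[OF h])
  then show ?thesis
    by (simp add: poly_mat_def linear_sum[OF linear_reindex] linear_scale[OF linear_reindex])
qed

lemma nonderogatory_reindex:
  fixes A :: "real^'m^'m" and h :: "'n::finite \<Rightarrow> 'm::finite"
  assumes h: "bij h" and "nonderogatory A"
  shows "nonderogatory (reindex h A)"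
proof -
  have "reindex h B = 0 \<longleftrightarrow> B = 0" for B :: "real^'m^'m"
    using inj_reindex[OF h] linear_0[OF linear_reindex, of h] by (metis injD)
  then show ?thesis
    using assms(2)
    by (simp add: nonderogatory_def is_min_poly_def char_poly_reindex[OF h] poly_mat_reindex[OF h])
qed

lemma G_psi_reindex:
  fixes A :: "real^'m^'m" and h :: "'n::finite \<Rightarrow> 'm::finite"
  assumes h: "bij h"
  shows "G_psi A \<cong>\<^sub>L G_psi (reindex h A)"
proof (rule lie_iso_linearI)
  let ?f = "\<lambda>(B :: real^'m^'m, x :: real^'m). (reindex h B, (\<chi> i. x $ h i) :: real^'n)"
  have polys: "matrix_polys (reindex h A) = reindex h ` matrix_polys A"
    by (auto simp: matrix_polys_def poly_mat_reindex[OF h])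
  show "linear ?f"
    by (rule linearI) (auto simp: linear_add[OF linear_reindex] linear_scale[OF linear_reindex]
      vec_eq_iff)
  show "inj_on ?f (lcarrier (G_psi A))"
  proof (rule inj_onI)
    fix p q assume eq: "?f p = ?f q"
    obtain B x C y where pq: "p = (B, x)" "q = (C, y)" by (cases p; cases q)
    have "B = C" using eq pq inj_reindex[OF h] by (auto dest: injD)
    moreover have "x $ i = y $ i" for i
    proof -
      obtain k where "i = h k" using h by (metis bij_pointE)
      then show ?thesis using eq pq by (simp add: vec_eq_iff)
    qed
    ultimately show "p = q" by (simp add: pq vec_eq_iff)
  qed
  have "(reindex h B, y) \<in> ?f ` lcarrier (G_psi A)" if "B \<in> matrix_polys A" for B y
  proof (rule image_eqI[of _ _ "(B, \<chi> i. y $ inv h i)"])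
    show "(reindex h B, y) = ?f (B, \<chi> i. y $ inv h i)"
      using h by (simp add: vec_eq_iff bij_is_inj)
  qed (use that in \<open>simp add: G_psi_def semidirect_def\<close>)
  then show "?f ` lcarrier (G_psi A) = lcarrier (G_psi (reindex h A))"
    by (auto simp: G_psi_def semidirect_def polys)
  show "?f (lbracket (G_psi A) p q) = lbracket (G_psi (reindex h A)) (?f p) (?f q)" for p q
    by (cases p; cases q) (simp add: G_psi_def semidirect_def reindex_mult_vec[OF h]
      linear_0[OF linear_reindex] vec_eq_iff)
qed

text \<open>The \<open>itself\<close> argument fixes the index type, which otherwise occurs only
  under the quantifier.\<close>

definition G_psi_like :: "'n::finite itself \<Rightarrow> 'a::real_vector lie \<Rightarrow> bool" where
  "G_psi_like _ L \<longleftrightarrow> (\<exists>\<psi> :: real^'n^'n. nonderogatory \<psi> \<and> L \<cong>\<^sub>L G_psi \<psi>)"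

lemma G_psi_like_transfer:
  assumes "CARD('n::finite) = CARD('m::finite)" and "G_psi_like TYPE('m) L"
  shows "G_psi_like TYPE('n) L"
proof -
  obtain h :: "'n \<Rightarrow> 'm" where h: "bij h"
    using finite_same_card_bij[of "UNIV :: 'n set" "UNIV :: 'm set"] assms(1) by auto
  obtain \<psi> :: "real^'m^'m" where "nonderogatory \<psi>" "L \<cong>\<^sub>L G_psi \<psi>"
    using assms(2) unfolding G_psi_like_def by blast
  then show ?thesis
    unfolding G_psi_like_def
    using nonderogatory_reindex[OF h] G_psi_reindex[OF h] lie_iso_trans by blast
qed

lemma G_psi_likeI:
  fixes \<psi> :: "real^'n^'n"
  assumes "L \<cong>\<^sub>L matrix_model A" and "nonderogatory \<psi>" and "matrix_model A \<cong>\<^sub>L G_psi \<psi>"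
  shows "G_psi_like TYPE('n) L"
  using assms lie_iso_trans unfolding G_psi_like_def by blast

section \<open>From the classification of algebras to that of Lie algebras\<close>

lemmas (in commutative_algebra) comb_simps = comb2_def comb3_def mult_simps

lemma dual_model_1:
  fixes m :: "real^1 \<Rightarrow> real^1 \<Rightarrow> real^1"
  assumes "commutative_algebra m one"
  shows "dual_model m \<cong>\<^sub>L matrix_model A_1"
proof -
  interpret commutative_algebra m one by fact
  define T where "T x = x $ 1 *\<^sub>R one" for x :: "real^1"
  have T: "linear T" by (rule linearI) (simp_all add: T_def algebra_simps)
  have "inj T" using unit_nonzero by (intro linear_injI T) (simp add: T_def vec_eq_iff)
  then have "bij T" using linear_injective_imp_surjective[OF T] by (simp add: bij_def)
  then show ?thesis
    by (rule dual_model_iso[OF bilinear T, where m' = "\<lambda>x y. vec (x $ 1 * y $ 1)"])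
      (simp_all add: T_def mult_simps A_1_def inner_vec_def matrix_vector_mult_def mat_def)
qed

text \<open>Each m' is the multiplication table of the normal form in the basis supplied by the
  classification. The remaining computation confirms that the matrix assigned to a is the transpose
  of multiplication by a.\<close>

lemma dual_model_2:
  fixes m :: "real^2 \<Rightarrow> real^2 \<Rightarrow> real^2"
  assumes "commutative_algebra m one"
  obtains "dual_model m \<cong>\<^sub>L matrix_model A_RR" | "dual_model m \<cong>\<^sub>L matrix_model A_E"
  | "dual_model m \<cong>\<^sub>L matrix_model A_C"
proof -
  interpret commutative_algebra m one by fact
  have dim: "DIM(real^2) = 2" by simp
  note iso = dual_model_iso[OF bilinear linear_comb2 bij_comb2[OF dim]]
  show thesis
  proof (rule classification_2[OF dim])
    fix x y assume xy: "ind2 x y" "m x x = x" "m y y = y" "m x y = 0"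
    have "dual_model m \<cong>\<^sub>L matrix_model A_RR"
      by (rule iso[OF xy(1), where m' = "\<lambda>a b. vector [a $ 1 * b $ 1, a $ 2 * b $ 2]"])
        (simp_all add: comb_simps xy commute[of y x] A_RR_def vec2)
    then show thesis by (rule that(1))
  next
    fix y assume y: "ind2 one y" "m y y = 0"
    have "dual_model m \<cong>\<^sub>L matrix_model A_E"
      by (rule iso[OF y(1), where
          m' = "\<lambda>a b. vector [a $ 1 * b $ 1, a $ 1 * b $ 2 + a $ 2 * b $ 1]"])
        (simp_all add: comb_simps y A_E_def vec2 algebra_simps)
    then show thesis by (rule that(2))
  next
    fix y assume y: "ind2 one y" "m y y = - one"
    have "dual_model m \<cong>\<^sub>L matrix_model A_C"
      by (rule iso[OF y(1), where
          m' = "\<lambda>a b. vector [a $ 1 * b $ 1 - a $ 2 * b $ 2, a $ 1 * b $ 2 + a $ 2 * b $ 1]"])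
        (simp_all add: comb_simps y A_C_def vec2 algebra_simps)
    then show thesis by (rule that(3))
  qed
qed

lemma dual_model_3:
  fixes m :: "real^3 \<Rightarrow> real^3 \<Rightarrow> real^3"
  assumes "commutative_algebra m one"
  obtains "dual_model m \<cong>\<^sub>L matrix_model A_RRR" | "dual_model m \<cong>\<^sub>L matrix_model A_ER"
  | "dual_model m \<cong>\<^sub>L matrix_model A_CR" | "dual_model m \<cong>\<^sub>L matrix_model A_N"
  | "dual_model m \<cong>\<^sub>L matrix_model A_31"
proof -
  interpret commutative_algebra m one by fact
  have dim: "DIM(real^3) = 3" by simp
  note iso = dual_model_iso[OF bilinear linear_comb3 bij_comb3[OF dim]]
  show thesis
  proof (rule classification_3[OF dim])
    fix x y z assume "idempotent_basis x y z"
    then have xyz: "ind3 x y z" "m x x = x" "m z z = z" "m x z = 0" "m y z = 0"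
      and y: "m x y = 0 \<and> m y y = y \<or> m x y = y \<and> m y y = 0 \<or> m x y = y \<and> m y y = - x"
      by (auto simp: idempotent_basis_def)
    note simps = comb_simps xyz commute[of y x] commute[of z x] commute[of z y] vec3 algebra_simps
    consider "m x y = 0" "m y y = y" | "m x y = y" "m y y = 0" | "m x y = y" "m y y = - x"
      using y by blast
    then show thesis
    proof cases
      case 1
      have "dual_model m \<cong>\<^sub>L matrix_model A_RRR"
        by (rule iso[OF xyz(1), where
            m' = "\<lambda>a b. vector [a $ 1 * b $ 1, a $ 2 * b $ 2, a $ 3 * b $ 3]"])
          (simp_all add: simps 1 A_RRR_def)
      then show ?thesis by (rule that(1))
    next
      case 2
      have "dual_model m \<cong>\<^sub>L matrix_model A_ER"
        by (rule iso[OF xyz(1), where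
            m' = "\<lambda>a b. vector [a $ 1 * b $ 1, a $ 1 * b $ 2 + a $ 2 * b $ 1, a $ 3 * b $ 3]"])
          (simp_all add: simps 2 A_ER_def)
      then show ?thesis by (rule that(2))
    next
      case 3
      have "dual_model m \<cong>\<^sub>L matrix_model A_CR"
        by (rule iso[OF xyz(1), where
            m' = "\<lambda>a b. vector [a $ 1 * b $ 1 - a $ 2 * b $ 2, a $ 1 * b $ 2 + a $ 2 * b $ 1,
              a $ 3 * b $ 3]"])
          (simp_all add: simps 3 A_CR_def)
      then show ?thesis by (rule that(3))
    qed
  next
    fix y z assume yz: "ind3 one y z" "m y y = z" "m y z = 0" "m z z = 0"
    have "dual_model m \<cong>\<^sub>L matrix_model A_N"
      by (rule iso[OF yz(1), where m' = "\<lambda>a b. vector [a $ 1 * b $ 1,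
          a $ 1 * b $ 2 + a $ 2 * b $ 1, a $ 1 * b $ 3 + a $ 2 * b $ 2 + a $ 3 * b $ 1]"])
        (simp_all add: comb_simps yz commute[of z y] vec3 A_N_def algebra_simps)
    then show thesis by (rule that(4))
  next
    fix y z assume yz: "ind3 one y z" "m y y = 0" "m y z = 0" "m z z = 0"
    have "dual_model m \<cong>\<^sub>L matrix_model A_31"
      by (rule iso[OF yz(1), where m' = "\<lambda>a b. vector [a $ 1 * b $ 1,
          a $ 1 * b $ 2 + a $ 2 * b $ 1, a $ 1 * b $ 3 + a $ 3 * b $ 1]"])
        (simp_all add: comb_simps yz commute[of z y] vec3 A_31_def algebra_simps)
    then show thesis by (rule that(5))
  qed
qed

lemma (in frobenius_bracket) dual_model:
  assumes "dim cent = CARD('n::finite)"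
  obtains m :: "real^'n \<Rightarrow> real^'n \<Rightarrow> real^'n" and one where "commutative_algebra m one"
    "\<lparr>lcarrier = UNIV, lbracket = br\<rparr> \<cong>\<^sub>L dual_model m"
proof -
  obtain m :: "real^'n \<Rightarrow> real^'n \<Rightarrow> real^'n" and one F where m: "commutative_algebra m one"
    and F: "linear F" "bij F"
    and br: "\<And>x d x' d'. br (F (x, d)) (F (x', d')) = F (0, adjoint (m x) d' - adjoint (m x') d)"
    using presentation[OF assms] by metis
  have "\<lparr>lcarrier = UNIV, lbracket = br\<rparr> \<cong>\<^sub>L dual_model m"
    by (rule lie_iso_linear_symI[OF F(1)])
      (use F(2) br in \<open>auto simp: dual_model_def bij_is_inj bij_is_surj\<close>)
  then show thesis using m that by blast
qed

text \<open>The type \<open>'k\<close> only provides coordinates for the carrier; the size of the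
  model is governed by \<open>dim cent\<close>.\<close>

lemma frobenius_dual_model_coordinates:
  fixes L :: "'a::real_vector lie"
  assumes L: "lie_algebra L" "two_step_solvable L" "frobenius L"
    and k: "dim (lcarrier L) = CARD('k::finite)" and le: "dim (lcarrier L) \<le> 6"
  obtains m :: "real^1 \<Rightarrow> real^1 \<Rightarrow> real^1" and one where
    "commutative_algebra m one" "L \<cong>\<^sub>L dual_model m" "dim (lcarrier L) = 2"
  | m :: "real^2 \<Rightarrow> real^2 \<Rightarrow> real^2" and one where
    "commutative_algebra m one" "L \<cong>\<^sub>L dual_model m" "dim (lcarrier L) = 4"
  | m :: "real^3 \<Rightarrow> real^3 \<Rightarrow> real^3" and one where
    "commutative_algebra m one" "L \<cong>\<^sub>L dual_model m" "dim (lcarrier L) = 6"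
proof -
  obtain br :: "real^'k \<Rightarrow> real^'k \<Rightarrow> real^'k" and \<alpha> where fb: "frobenius_bracket br \<alpha>"
    and iso: "L \<cong>\<^sub>L \<lparr>lcarrier = UNIV, lbracket = br\<rparr>"
    using frobenius_bracket_coordinates[OF L(1) k L(2,3)] by metis
  interpret frobenius_bracket br \<alpha> by fact
  \<comment> \<open>A vanishing principal element would make \<alpha> zero and the form
    degenerate.\<close>
  have "principal \<noteq> 0"
  proof
    assume "principal = 0"
    then have \<alpha>: "\<alpha> v = 0" for v
      using principal[of v] by (simp add: br_simps functional_simps)
    have "axis undefined 1 = (0 :: real^'k)" by (rule nondegenerate) (rule \<alpha>)
    then show False by (simp add: axis_eq_0_iff)
  qed
  then have "dim cent \<noteq> 0" using principal_cent by auto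
  \<comment> \<open>A crude bound that leaves finitely many numeral types.
    \<open>DIM_eq_2_dim_cent\<close> needs a type of cardinality \<open>dim cent\<close>, so the
    values 4, 5 and 6 are refuted one at a time.\<close>
  moreover have "dim cent \<le> 6"
    using dim_subset_UNIV[of cent] k le by simp
  ultimately consider "dim cent = 1" | "dim cent = 2" | "dim cent = 3" | "dim cent = 4"
    | "dim cent = 5" | "dim cent = 6" by linarith
  then show thesis
  proof cases
    case 1
    then have c: "dim cent = CARD(1)" by simp
    obtain m :: "real^1 \<Rightarrow> real^1 \<Rightarrow> real^1" and one where "commutative_algebra m one"
      "\<lparr>lcarrier = UNIV, lbracket = br\<rparr> \<cong>\<^sub>L dual_model m" by (rule dual_model[OF c])
    then show ?thesis
      by (intro that(1)[OF _ lie_iso_trans[OF iso]]) (use DIM_eq_2_dim_cent[OF c] k in simp_all)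
  next
    case 2
    then have c: "dim cent = CARD(2)" by simp
    obtain m :: "real^2 \<Rightarrow> real^2 \<Rightarrow> real^2" and one where "commutative_algebra m one"
      "\<lparr>lcarrier = UNIV, lbracket = br\<rparr> \<cong>\<^sub>L dual_model m" by (rule dual_model[OF c])
    then show ?thesis
      by (intro that(2)[OF _ lie_iso_trans[OF iso]]) (use DIM_eq_2_dim_cent[OF c] k in simp_all)
  next
    case 3
    then have c: "dim cent = CARD(3)" by simp
    obtain m :: "real^3 \<Rightarrow> real^3 \<Rightarrow> real^3" and one where "commutative_algebra m one"
      "\<lparr>lcarrier = UNIV, lbracket = br\<rparr> \<cong>\<^sub>L dual_model m" by (rule dual_model[OF c])
    then show ?thesis
      by (intro that(3)[OF _ lie_iso_trans[OF iso]]) (use DIM_eq_2_dim_cent[OF c] k in simp_all)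
  next
    case 4
    then show ?thesis using DIM_eq_2_dim_cent[where 'n = 4] k le by simp
  next
    case 5
    then show ?thesis using DIM_eq_2_dim_cent[where 'n = 5] k le by simp
  next
    case 6
    then show ?thesis using DIM_eq_2_dim_cent[where 'n = 6] k le by simp
  qed
qed

text \<open>Each possible dimension is matched with a numeral type; for the odd ones all
  alternatives are still offered, each carrying an even value of the dimension.\<close>

lemma frobenius_dual_model:
  fixes L :: "'a::real_vector lie"
  assumes L: "lie_algebra L" "two_step_solvable L" "frobenius L"
    and dim: "0 < dim (lcarrier L)" "dim (lcarrier L) \<le> 6"
  obtains m :: "real^1 \<Rightarrow> real^1 \<Rightarrow> real^1" and one where
    "commutative_algebra m one" "L \<cong>\<^sub>L dual_model m" "dim (lcarrier L) = 2"
  | m :: "real^2 \<Rightarrow> real^2 \<Rightarrow> real^2" and one where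
    "commutative_algebra m one" "L \<cong>\<^sub>L dual_model m" "dim (lcarrier L) = 4"
  | m :: "real^3 \<Rightarrow> real^3 \<Rightarrow> real^3" and one where
    "commutative_algebra m one" "L \<cong>\<^sub>L dual_model m" "dim (lcarrier L) = 6"
proof -
  consider "dim (lcarrier L) = CARD(1)" | "dim (lcarrier L) = CARD(2)"
    | "dim (lcarrier L) = CARD(3)" | "dim (lcarrier L) = CARD(4)"
    | "dim (lcarrier L) = CARD(5)" | "dim (lcarrier L) = CARD(6)"
    using dim by simp linarith
  then show thesis
    by cases (erule frobenius_dual_model_coordinates[OF L _ dim(2)]; rule that; assumption)+
qed

theorem theorem8p1:
  fixes L :: "'a::real_vector lie"
  assumes "lie_algebra L"
    and "0 < dim (lcarrier L)" and "dim (lcarrier L) \<le> 6"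
    and "two_step_solvable L"
    and "frobenius L"
  shows "(dim (lcarrier L) = 2 * CARD('n::finite) \<longrightarrow>
            (\<exists>\<psi> :: real^'n^'n. nonderogatory \<psi> \<and> L \<cong>\<^sub>L G_psi \<psi>) \<or> L \<cong>\<^sub>L G_3_1)
       \<and> (L \<cong>\<^sub>L aff_R
          \<or> L \<cong>\<^sub>L (D_0 :: ((real^2^2) \<times> (real^2)) lie)
          \<or> L \<cong>\<^sub>L aff_C
          \<or> L \<cong>\<^sub>L (D_0 :: ((real^3^3) \<times> (real^3)) lie)
          \<or> L \<cong>\<^sub>L G_3_1
          \<or> L \<cong>\<^sub>L aff_R \<oplus>\<^sub>L aff_R
          \<or> L \<cong>\<^sub>L (D_0 :: ((real^2^2) \<times> (real^2)) lie) \<oplus>\<^sub>L aff_R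
          \<or> L \<cong>\<^sub>L aff_C \<oplus>\<^sub>L aff_R
          \<or> L \<cong>\<^sub>L aff_R \<oplus>\<^sub>L aff_R \<oplus>\<^sub>L aff_R)"
proof (rule frobenius_dual_model[OF assms(1,4,5,2,3)])
  fix m :: "real^1 \<Rightarrow> real^1 \<Rightarrow> real^1" and one
  assume "commutative_algebra m one" "L \<cong>\<^sub>L dual_model m" and dim: "dim (lcarrier L) = 2"
  then have L: "L \<cong>\<^sub>L matrix_model A_1" using dual_model_1 lie_iso_trans by blast
  have "G_psi_like TYPE('n) L" if "dim (lcarrier L) = 2 * CARD('n)"
    by (rule G_psi_like_transfer[OF _ G_psi_likeI[OF L G_psi_1]]) (use that dim in simp)
  then show ?thesis
    using lie_iso_trans[OF L matrix_model_aff_R] unfolding G_psi_like_def by blast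
next
  fix m :: "real^2 \<Rightarrow> real^2 \<Rightarrow> real^2" and one
  assume m: "commutative_algebra m one" and L: "L \<cong>\<^sub>L dual_model m"
    and dim: "dim (lcarrier L) = 4"
  have *: "dim (lcarrier L) = 2 * CARD('n) \<longrightarrow>
      (\<exists>\<psi> :: real^'n^'n. nonderogatory \<psi> \<and> L \<cong>\<^sub>L G_psi \<psi>)" if "G_psi_like TYPE(2) L"
    using G_psi_like_transfer[where 'n = 'n, OF _ that] dim unfolding G_psi_like_def by simp
  show ?thesis
    using m
  proof (rule dual_model_2)
    assume "dual_model m \<cong>\<^sub>L matrix_model A_RR"
    then have L: "L \<cong>\<^sub>L matrix_model A_RR" by (rule lie_iso_trans[OF L])
    show ?thesis
      using *[OF G_psi_likeI[OF L G_psi_RR]] lie_iso_trans[OF L matrix_model_RR] by blast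
  next
    assume "dual_model m \<cong>\<^sub>L matrix_model A_E"
    then have L: "L \<cong>\<^sub>L matrix_model A_E" by (rule lie_iso_trans[OF L])
    show ?thesis
      using *[OF G_psi_likeI[OF L G_psi_E]] lie_iso_trans[OF L matrix_model_E] by blast
  next
    assume "dual_model m \<cong>\<^sub>L matrix_model A_C"
    then have L: "L \<cong>\<^sub>L matrix_model A_C" by (rule lie_iso_trans[OF L])
    show ?thesis
      using *[OF G_psi_likeI[OF L G_psi_C]] lie_iso_trans[OF L matrix_model_C] by blast
  qed
next
  fix m :: "real^3 \<Rightarrow> real^3 \<Rightarrow> real^3" and one
  assume m: "commutative_algebra m one" and L: "L \<cong>\<^sub>L dual_model m"
    and dim: "dim (lcarrier L) = 6"
  have *: "dim (lcarrier L) = 2 * CARD('n) \<longrightarrow>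
      (\<exists>\<psi> :: real^'n^'n. nonderogatory \<psi> \<and> L \<cong>\<^sub>L G_psi \<psi>)" if "G_psi_like TYPE(3) L"
    using G_psi_like_transfer[where 'n = 'n, OF _ that] dim unfolding G_psi_like_def by simp
  show ?thesis
    using m
  proof (rule dual_model_3)
    assume "dual_model m \<cong>\<^sub>L matrix_model A_RRR"
    then have L: "L \<cong>\<^sub>L matrix_model A_RRR" by (rule lie_iso_trans[OF L])
    show ?thesis
      using *[OF G_psi_likeI[OF L G_psi_RRR]] lie_iso_trans[OF L matrix_model_RRR] by blast
  next
    assume "dual_model m \<cong>\<^sub>L matrix_model A_ER"
    then have L: "L \<cong>\<^sub>L matrix_model A_ER" by (rule lie_iso_trans[OF L])
    show ?thesis
      using *[OF G_psi_likeI[OF L G_psi_ER]] lie_iso_trans[OF L matrix_model_ER] by blast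
  next
    assume "dual_model m \<cong>\<^sub>L matrix_model A_CR"
    then have L: "L \<cong>\<^sub>L matrix_model A_CR" by (rule lie_iso_trans[OF L])
    show ?thesis
      using *[OF G_psi_likeI[OF L G_psi_CR]] lie_iso_trans[OF L matrix_model_CR] by blast
  next
    assume "dual_model m \<cong>\<^sub>L matrix_model A_N"
    then have L: "L \<cong>\<^sub>L matrix_model A_N" by (rule lie_iso_trans[OF L])
    show ?thesis
      using *[OF G_psi_likeI[OF L G_psi_N]] lie_iso_trans[OF L matrix_model_N] by blast
  next
    assume "dual_model m \<cong>\<^sub>L matrix_model A_31"
    \<comment> \<open>\<open>G_3_1\<close> is an alternative in both conjuncts of the goal.\<close>
    then have "L \<cong>\<^sub>L G_3_1" using lie_iso_trans[OF L] matrix_model_31 lie_iso_trans by blast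
    then show ?thesis by blast
  qed
qed

end
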